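(* Let $L$ be a finite simple group, let $t\geq 1$ be an integer, and let $Q=(L,t,1)$, where $1$ denotes the identity automorphism of $L$. The following are equivalent: (i) $Q$ is superfaithful. (ii) $Q$ is superconnected. (iii) $|L|$ and $t$ are coprime.
   Context: A left quasigroup is a set $Q$ with two binary operations $*,\backslash$ such that $x*(x\backslash y)=y=x\backslash(x*y)$ for all $x,y$; so each $L_x:y\mapsto x*y$ is a permutation of $Q$. A quandle is a left quasigroup with $x*x=x$ and $x*(y*z)=(x*y)*(x*z)$ for all $x,y,z$. $\mathrm{LMlt}(Q)=\langle L_x : x\in Q\rangle$. A subalgebra is a nonempty subset closed under $*$ and $\backslash$. $Q$ is connected if $\mathrm{LMlt}(Q)$ is transitive on $Q$, and superconnected if every subalgebra of $Q$ is connected. $Q$ is faithful if $L_x=L_y$ implies $x=y$, and superfaithful if every subalgebra of $Q$ is faithful (as a left quasigroup in its own right). For a group $G$, $\theta\in\mathrm{Aut}(G)$ and $H\leq \mathrm{Fix}(\theta)=\{x\in G:\theta(x)=x\}$, the coset quandle $\mathcal{Q}(G,H,\theta)$ is the set $G/H$ of left cosets with $xH*yH=x\theta(x^{-1}y)H$. For $t\geq 1$ let $\theta_t\in\mathrm{Aut}(G^t)$, $\theta_t(x_1,\ldots,x_t)=(\theta(x_t),x_1,\ldots,x_{t-1})$; its fixed points are $H_t=\{(x,\ldots,x):x\in \mathrm{Fix}(\theta)\}$. Then $(G,t,\theta)$ denotes the quandle $\mathcal{Q}(G^t,H_t,\theta_t)$. *)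

theory Defs
  imports "HOL-Algebra.Algebra"
begin

record 'a lq_struct = "'a partial_object" +
  lq_mult :: "['a, 'a] \<Rightarrow> 'a" (infixl \<open>\<star>\<index>\<close> 70)
  lq_ldiv :: "['a, 'a] \<Rightarrow> 'a" (infixl \<open>\<setminus>\<index>\<close> 70)

locale left_quasigroup =
  fixes Q :: "('a, 'b) lq_struct_scheme" (structure)
  assumes mult_closed: "\<lbrakk>x \<in> carrier Q; y \<in> carrier Q\<rbrakk> \<Longrightarrow> x \<star> y \<in> carrier Q"
    and ldiv_closed: "\<lbrakk>x \<in> carrier Q; y \<in> carrier Q\<rbrakk> \<Longrightarrow> x \<setminus> y \<in> carrier Q"
    and mult_ldiv: "\<lbrakk>x \<in> carrier Q; y \<in> carrier Q\<rbrakk> \<Longrightarrow> x \<star> (x \<setminus> y) = y"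
    and ldiv_mult: "\<lbrakk>x \<in> carrier Q; y \<in> carrier Q\<rbrakk> \<Longrightarrow> x \<setminus> (x \<star> y) = y"

locale quandle = left_quasigroup +
  assumes idem: "x \<in> carrier Q \<Longrightarrow> x \<star> x = x"
    and left_distrib: "\<lbrakk>x \<in> carrier Q; y \<in> carrier Q; z \<in> carrier Q\<rbrakk>
      \<Longrightarrow> x \<star> (y \<star> z) = (x \<star> y) \<star> (x \<star> z)"

definition left_translation :: "('a, 'b) lq_struct_scheme \<Rightarrow> 'a \<Rightarrow> 'a \<Rightarrow> 'a"
  where "left_translation Q x = (\<lambda>y\<in>carrier Q. x \<star>\<^bsub>Q\<^esub> y)"

definition LMlt :: "('a, 'b) lq_struct_scheme \<Rightarrow> ('a \<Rightarrow> 'a) set"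
  where "LMlt Q = generate (BijGroup (carrier Q)) (left_translation Q ` carrier Q)"

definition subalgebra :: "'a set \<Rightarrow> ('a, 'b) lq_struct_scheme \<Rightarrow> bool"
  where "subalgebra S Q \<longleftrightarrow> S \<noteq> {} \<and> S \<subseteq> carrier Q \<and>
    (\<forall>x\<in>S. \<forall>y\<in>S. x \<star>\<^bsub>Q\<^esub> y \<in> S \<and> x \<setminus>\<^bsub>Q\<^esub> y \<in> S)"

definition connected_lq :: "('a, 'b) lq_struct_scheme \<Rightarrow> bool"
  where "connected_lq Q \<longleftrightarrow> (\<forall>x\<in>carrier Q. \<forall>y\<in>carrier Q. \<exists>f\<in>LMlt Q. f x = y)"

definition superconnected :: "('a, 'b) lq_struct_scheme \<Rightarrow> bool"
  where "superconnected Q \<longleftrightarrow> (\<forall>S. subalgebra S Q \<longrightarrow> connected_lq (Q\<lparr>carrier := S\<rparr>))"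

definition faithful_lq :: "('a, 'b) lq_struct_scheme \<Rightarrow> bool"
  where "faithful_lq Q \<longleftrightarrow> inj_on (left_translation Q) (carrier Q)"

definition superfaithful :: "('a, 'b) lq_struct_scheme \<Rightarrow> bool"
  where "superfaithful Q \<longleftrightarrow> (\<forall>S. subalgebra S Q \<longrightarrow> faithful_lq (Q\<lparr>carrier := S\<rparr>))"

text \<open>The operations on cosets are unions over all representatives; when \<^term>\<open>\<theta>\<close> is an
  automorphism fixing \<^term>\<open>H\<close> pointwise, all members of the union coincide
  (see \<open>coset_quandle_mult\<close>). The left division is the one forced by the multiplication:
  \<open>xH \<setminus> yH = x \<theta>\<^sup>-\<^sup>1(x\<^sup>-\<^sup>1y)H\<close>.\<close>

definition coset_op :: "('a, 'b) monoid_scheme \<Rightarrow> 'a set \<Rightarrow> ('a \<Rightarrow> 'a) \<Rightarrow> 'a set \<Rightarrow> 'a set \<Rightarrow> 'a set"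
  where "coset_op G H \<theta> A B =
    (\<Union>x\<in>A. \<Union>y\<in>B. (x \<otimes>\<^bsub>G\<^esub> \<theta> (inv\<^bsub>G\<^esub> x \<otimes>\<^bsub>G\<^esub> y)) <#\<^bsub>G\<^esub> H)"

definition coset_quandle :: "('a, 'b) monoid_scheme \<Rightarrow> 'a set \<Rightarrow> ('a \<Rightarrow> 'a) \<Rightarrow> 'a set lq_struct"
  where "coset_quandle G H \<theta> =
    \<lparr>carrier = lcosets\<^bsub>G\<^esub> H,
     lq_mult = coset_op G H \<theta>,
     lq_ldiv = coset_op G H (inv_into (carrier G) \<theta>)\<rparr>"

abbreviation power_group :: "('a, 'b) monoid_scheme \<Rightarrow> nat \<Rightarrow> (nat \<Rightarrow> 'a) monoid"
  where "power_group G t \<equiv> product_group {1..t} (\<lambda>_. G)"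

definition shift_aut :: "('a, 'b) monoid_scheme \<Rightarrow> nat \<Rightarrow> ('a \<Rightarrow> 'a) \<Rightarrow> (nat \<Rightarrow> 'a) \<Rightarrow> nat \<Rightarrow> 'a"
  where "shift_aut G t \<theta> =
    (\<lambda>x\<in>carrier (power_group G t). \<lambda>i\<in>{1..t}. if i = 1 then \<theta> (x t) else x (i - 1))"

definition diag_fix :: "('a, 'b) monoid_scheme \<Rightarrow> nat \<Rightarrow> ('a \<Rightarrow> 'a) \<Rightarrow> (nat \<Rightarrow> 'a) set"
  where "diag_fix G t \<theta> = {(\<lambda>i\<in>{1..t}. x) | x. x \<in> carrier G \<and> \<theta> x = x}"

definition power_quandle ::
    "('a, 'b) monoid_scheme \<Rightarrow> nat \<Rightarrow> ('a \<Rightarrow> 'a) \<Rightarrow> (nat \<Rightarrow> 'a) set lq_struct"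
  where "power_quandle G t \<theta> =
    coset_quandle (power_group G t) (diag_fix G t \<theta>) (shift_aut G t \<theta>)"

lemma coset_op_lcosets:
  assumes "group G" "subgroup H G" "\<theta> \<in> hom G G" "\<And>h. h \<in> H \<Longrightarrow> \<theta> h = h"
    and x: "x \<in> carrier G" and y: "y \<in> carrier G"
  shows "coset_op G H \<theta> (x <#\<^bsub>G\<^esub> H) (y <#\<^bsub>G\<^esub> H) =
    (x \<otimes>\<^bsub>G\<^esub> \<theta> (inv\<^bsub>G\<^esub> x \<otimes>\<^bsub>G\<^esub> y)) <#\<^bsub>G\<^esub> H"
proof -
  interpret group G by fact
  interpret H: subgroup H G by fact
  have th: "\<And>a. a \<in> carrier G \<Longrightarrow> \<theta> a \<in> carrier G"
    "\<And>a b. a \<in> carrier G \<Longrightarrow> b \<in> carrier G \<Longrightarrow> \<theta> (a \<otimes>\<^bsub>G\<^esub> b) = \<theta> a \<otimes>\<^bsub>G\<^esub> \<theta> b"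
    using assms(3) by (auto simp: hom_def)
  have *: "((x \<otimes>\<^bsub>G\<^esub> h) \<otimes>\<^bsub>G\<^esub> \<theta> (inv\<^bsub>G\<^esub> (x \<otimes>\<^bsub>G\<^esub> h) \<otimes>\<^bsub>G\<^esub> (y \<otimes>\<^bsub>G\<^esub> k))) <#\<^bsub>G\<^esub> H =
     (x \<otimes>\<^bsub>G\<^esub> \<theta> (inv\<^bsub>G\<^esub> x \<otimes>\<^bsub>G\<^esub> y)) <#\<^bsub>G\<^esub> H" if h: "h \<in> H" and k: "k \<in> H" for h k
  proof -
    have hk: "h \<in> carrier G" "k \<in> carrier G" using h k by auto
    have "\<theta> (inv\<^bsub>G\<^esub> (x \<otimes>\<^bsub>G\<^esub> h) \<otimes>\<^bsub>G\<^esub> (y \<otimes>\<^bsub>G\<^esub> k)) = \<theta> (inv\<^bsub>G\<^esub> h \<otimes>\<^bsub>G\<^esub> ((inv\<^bsub>G\<^esub> x \<otimes>\<^bsub>G\<^esub> y) \<otimes>\<^bsub>G\<^esub> k))"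
      using hk x y by (simp add: inv_mult_group m_assoc)
    also have "\<dots> = inv\<^bsub>G\<^esub> h \<otimes>\<^bsub>G\<^esub> (\<theta> (inv\<^bsub>G\<^esub> x \<otimes>\<^bsub>G\<^esub> y) \<otimes>\<^bsub>G\<^esub> k)"
      using hk h k x y by (simp add: th(2) assms(4))
    finally have "(x \<otimes>\<^bsub>G\<^esub> h) \<otimes>\<^bsub>G\<^esub> \<theta> (inv\<^bsub>G\<^esub> (x \<otimes>\<^bsub>G\<^esub> h) \<otimes>\<^bsub>G\<^esub> (y \<otimes>\<^bsub>G\<^esub> k))
        = (x \<otimes>\<^bsub>G\<^esub> \<theta> (inv\<^bsub>G\<^esub> x \<otimes>\<^bsub>G\<^esub> y)) \<otimes>\<^bsub>G\<^esub> k"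
      using hk x y th(1) by (simp add: m_assoc inv_solve_left flip: m_assoc[of h "inv\<^bsub>G\<^esub> h"])
    moreover have "k <#\<^bsub>G\<^esub> H = H" using k by (metis assms(2) coset_join3 hk(2))
    ultimately show ?thesis
      using hk x y th(1) by (simp add: lcos_m_assoc[symmetric] H.subset)
  qed
  have ne: "H \<noteq> {}" using H.one_closed by blast
  have "coset_op G H \<theta> (x <#\<^bsub>G\<^esub> H) (y <#\<^bsub>G\<^esub> H) = (\<Union>h\<in>H. \<Union>k\<in>H.
     ((x \<otimes>\<^bsub>G\<^esub> h) \<otimes>\<^bsub>G\<^esub> \<theta> (inv\<^bsub>G\<^esub> (x \<otimes>\<^bsub>G\<^esub> h) \<otimes>\<^bsub>G\<^esub> (y \<otimes>\<^bsub>G\<^esub> k))) <#\<^bsub>G\<^esub> H)"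
    by (simp add: coset_op_def l_coset_def)
  also have "\<dots> = (\<Union>h\<in>H. \<Union>k\<in>H. (x \<otimes>\<^bsub>G\<^esub> \<theta> (inv\<^bsub>G\<^esub> x \<otimes>\<^bsub>G\<^esub> y)) <#\<^bsub>G\<^esub> H)"
    by (intro SUP_cong refl *)
  also have "\<dots> = (x \<otimes>\<^bsub>G\<^esub> \<theta> (inv\<^bsub>G\<^esub> x \<otimes>\<^bsub>G\<^esub> y)) <#\<^bsub>G\<^esub> H" using ne by auto
  finally show ?thesis .
qed

lemma auto_inv_into:
  assumes "group G" "\<theta> \<in> auto G"
  shows "inv_into (carrier G) \<theta> \<in> hom G G"
    and "x \<in> carrier G \<Longrightarrow> \<theta> (inv_into (carrier G) \<theta> x) = x"
    and "x \<in> carrier G \<Longrightarrow> inv_into (carrier G) \<theta> (\<theta> x) = x"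
proof -
  interpret group G by fact
  have "\<theta> \<in> iso G G" using assms(2) by (auto simp: auto_def iso_def Bij_def)
  then show "inv_into (carrier G) \<theta> \<in> hom G G" using iso_set_sym by (auto simp: iso_def)
  show "x \<in> carrier G \<Longrightarrow> \<theta> (inv_into (carrier G) \<theta> x) = x"
    "x \<in> carrier G \<Longrightarrow> inv_into (carrier G) \<theta> (\<theta> x) = x"
    using assms(2) by (auto simp: auto_def Bij_def bij_betw_def f_inv_into_f)
qed

lemma coset_quandle_mult:
  assumes "group G" "subgroup H G" "\<theta> \<in> auto G" "\<And>h. h \<in> H \<Longrightarrow> \<theta> h = h"
    and "x \<in> carrier G" "y \<in> carrier G"
  shows "(x <#\<^bsub>G\<^esub> H) \<star>\<^bsub>coset_quandle G H \<theta>\<^esub> (y <#\<^bsub>G\<^esub> H) =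
    (x \<otimes>\<^bsub>G\<^esub> \<theta> (inv\<^bsub>G\<^esub> x \<otimes>\<^bsub>G\<^esub> y)) <#\<^bsub>G\<^esub> H"
  using coset_op_lcosets[OF assms(1,2) _ assms(4-6)] assms(3)
  by (simp add: coset_quandle_def auto_def)

lemma coset_quandle_ldiv:
  assumes "group G" "subgroup H G" "\<theta> \<in> auto G" "\<And>h. h \<in> H \<Longrightarrow> \<theta> h = h"
    and "x \<in> carrier G" "y \<in> carrier G"
  shows "(x <#\<^bsub>G\<^esub> H) \<setminus>\<^bsub>coset_quandle G H \<theta>\<^esub> (y <#\<^bsub>G\<^esub> H) =
    (x \<otimes>\<^bsub>G\<^esub> inv_into (carrier G) \<theta> (inv\<^bsub>G\<^esub> x \<otimes>\<^bsub>G\<^esub> y)) <#\<^bsub>G\<^esub> H"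
proof -
  have "inv_into (carrier G) \<theta> h = h" if "h \<in> H" for h
    using that auto_inv_into(3)[OF assms(1,3), of h] assms(2,4) by (metis subgroup.mem_carrier)
  then show ?thesis
    using coset_op_lcosets[OF assms(1,2) auto_inv_into(1)[OF assms(1,3)]] assms(5,6)
    by (simp add: coset_quandle_def)
qed

theorem quandle_coset_quandle:
  assumes "group G" "subgroup H G" "\<theta> \<in> auto G" "\<And>h. h \<in> H \<Longrightarrow> \<theta> h = h"
  shows "quandle (coset_quandle G H \<theta>)"
proof -
  interpret group G by fact
  let ?Q = "coset_quandle G H \<theta>" and ?i = "inv_into (carrier G) \<theta>"
  have m: "(x <#\<^bsub>G\<^esub> H) \<star>\<^bsub>?Q\<^esub> (y <#\<^bsub>G\<^esub> H) = (x \<otimes>\<^bsub>G\<^esub> \<theta> (inv\<^bsub>G\<^esub> x \<otimes>\<^bsub>G\<^esub> y)) <#\<^bsub>G\<^esub> H"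
    and d: "(x <#\<^bsub>G\<^esub> H) \<setminus>\<^bsub>?Q\<^esub> (y <#\<^bsub>G\<^esub> H) = (x \<otimes>\<^bsub>G\<^esub> ?i (inv\<^bsub>G\<^esub> x \<otimes>\<^bsub>G\<^esub> y)) <#\<^bsub>G\<^esub> H"
    if "x \<in> carrier G" "y \<in> carrier G" for x y
    by (rule coset_quandle_mult coset_quandle_ldiv; use assms that in blast)+
  note inv = auto_inv_into[OF assms(1,3)]
  have hom: "\<theta> \<in> hom G G" using assms(3) by (simp add: auto_def)
  interpret th: group_hom G G \<theta> using hom by unfold_locales
  have ic: "?i a \<in> carrier G" if "a \<in> carrier G" for a
    using inv(1) that by (auto simp: hom_def)
  have c: "carrier ?Q = {x <#\<^bsub>G\<^esub> H | x. x \<in> carrier G}"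
    by (auto simp: coset_quandle_def LCOSETS_def)
  have cancel: "inv\<^bsub>G\<^esub> x \<otimes>\<^bsub>G\<^esub> (x \<otimes>\<^bsub>G\<^esub> a) = a" "x \<otimes>\<^bsub>G\<^esub> (inv\<^bsub>G\<^esub> x \<otimes>\<^bsub>G\<^esub> a) = a"
    if "x \<in> carrier G" "a \<in> carrier G" for x a
    using that by (simp_all flip: m_assoc)
  show ?thesis
  proof unfold_locales
    fix A B assume "A \<in> carrier ?Q" "B \<in> carrier ?Q"
    then obtain x y where xy: "x \<in> carrier G" "y \<in> carrier G" "A = x <#\<^bsub>G\<^esub> H" "B = y <#\<^bsub>G\<^esub> H"
      using c by auto
    have "x \<otimes>\<^bsub>G\<^esub> \<theta> (inv\<^bsub>G\<^esub> x \<otimes>\<^bsub>G\<^esub> y) \<in> carrier G" "x \<otimes>\<^bsub>G\<^esub> ?i (inv\<^bsub>G\<^esub> x \<otimes>\<^bsub>G\<^esub> y) \<in> carrier G"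
      using xy(1,2) ic by simp_all
    then show "A \<star>\<^bsub>?Q\<^esub> B \<in> carrier ?Q" "A \<setminus>\<^bsub>?Q\<^esub> B \<in> carrier ?Q"
      unfolding c xy(3,4) m[OF xy(1,2)] d[OF xy(1,2)] by blast+
    show "A \<star>\<^bsub>?Q\<^esub> (A \<setminus>\<^bsub>?Q\<^esub> B) = B" "A \<setminus>\<^bsub>?Q\<^esub> (A \<star>\<^bsub>?Q\<^esub> B) = B"
      using xy ic by (simp_all add: m d cancel inv del: th.hom_mult)
  next
    fix A assume "A \<in> carrier ?Q"
    then show "A \<star>\<^bsub>?Q\<^esub> A = A" using c by (auto simp: m)
  next
    fix A B C assume "A \<in> carrier ?Q" "B \<in> carrier ?Q" "C \<in> carrier ?Q"
    then obtain x y z where xyz: "x \<in> carrier G" "y \<in> carrier G" "z \<in> carrier G"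
      "A = x <#\<^bsub>G\<^esub> H" "B = y <#\<^bsub>G\<^esub> H" "C = z <#\<^bsub>G\<^esub> H"
      using c by auto
    let ?p = "x \<otimes>\<^bsub>G\<^esub> \<theta> (inv\<^bsub>G\<^esub> x \<otimes>\<^bsub>G\<^esub> y)" and ?q = "x \<otimes>\<^bsub>G\<^esub> \<theta> (inv\<^bsub>G\<^esub> x \<otimes>\<^bsub>G\<^esub> z)"
      and ?v = "\<theta> (inv\<^bsub>G\<^esub> y \<otimes>\<^bsub>G\<^esub> z)"
    have "inv\<^bsub>G\<^esub> ?p \<otimes>\<^bsub>G\<^esub> ?q = inv\<^bsub>G\<^esub> (\<theta> (inv\<^bsub>G\<^esub> x \<otimes>\<^bsub>G\<^esub> y)) \<otimes>\<^bsub>G\<^esub> \<theta> (inv\<^bsub>G\<^esub> x \<otimes>\<^bsub>G\<^esub> z)"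
      using xyz(1-3) by (simp add: inv_mult_group m_assoc cancel del: th.hom_mult)
    also have "\<dots> = \<theta> (inv\<^bsub>G\<^esub> (inv\<^bsub>G\<^esub> x \<otimes>\<^bsub>G\<^esub> y) \<otimes>\<^bsub>G\<^esub> (inv\<^bsub>G\<^esub> x \<otimes>\<^bsub>G\<^esub> z))"
      using xyz(1-3) by (simp del: inv_mult_group)
    also have "inv\<^bsub>G\<^esub> (inv\<^bsub>G\<^esub> x \<otimes>\<^bsub>G\<^esub> y) \<otimes>\<^bsub>G\<^esub> (inv\<^bsub>G\<^esub> x \<otimes>\<^bsub>G\<^esub> z) = inv\<^bsub>G\<^esub> y \<otimes>\<^bsub>G\<^esub> z"
      using xyz(1-3) by (simp add: inv_mult_group m_assoc cancel)
    finally have pq: "inv\<^bsub>G\<^esub> ?p \<otimes>\<^bsub>G\<^esub> ?q = ?v" .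
    have eq: "?p \<otimes>\<^bsub>G\<^esub> \<theta> ?v = x \<otimes>\<^bsub>G\<^esub> \<theta> (inv\<^bsub>G\<^esub> x \<otimes>\<^bsub>G\<^esub> (y \<otimes>\<^bsub>G\<^esub> ?v))"
      using xyz(1-3) by (simp add: m_assoc)
    have cl: "?p \<in> carrier G" "?q \<in> carrier G" "y \<otimes>\<^bsub>G\<^esub> ?v \<in> carrier G" using xyz(1-3) by simp_all
    have "(A \<star>\<^bsub>?Q\<^esub> B) \<star>\<^bsub>?Q\<^esub> (A \<star>\<^bsub>?Q\<^esub> C) = (?p \<otimes>\<^bsub>G\<^esub> \<theta> ?v) <#\<^bsub>G\<^esub> H"
      unfolding xyz(4-6) m[OF xyz(1,2)] m[OF xyz(1,3)] m[OF cl(1,2)] pq ..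
    also have "\<dots> = A \<star>\<^bsub>?Q\<^esub> (B \<star>\<^bsub>?Q\<^esub> C)"
      unfolding xyz(4-6) m[OF xyz(2,3)] m[OF xyz(1) cl(3)] eq ..
    finally show "A \<star>\<^bsub>?Q\<^esub> (B \<star>\<^bsub>?Q\<^esub> C) = (A \<star>\<^bsub>?Q\<^esub> B) \<star>\<^bsub>?Q\<^esub> (A \<star>\<^bsub>?Q\<^esub> C)" ..
  qed
qed

lemma diag_fix_eq:
  assumes "t \<ge> 1"
  shows "diag_fix G t \<theta> = {x \<in> carrier (power_group G t). shift_aut G t \<theta> x = x}"
proof (intro equalityI subsetI)
  fix x assume "x \<in> diag_fix G t \<theta>"
  then obtain a where x: "x = (\<lambda>i\<in>{1..t}. a)" and a: "a \<in> carrier G" "\<theta> a = a"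
    unfolding diag_fix_def by blast
  have c: "x \<in> carrier (power_group G t)" using x a by auto
  moreover have "shift_aut G t \<theta> x = x"
  proof
    fix i show "shift_aut G t \<theta> x i = x i"
      using c x a assms by (cases "i \<in> {1..t}"; cases "i = 1"; auto simp: shift_aut_def)
  qed
  ultimately show "x \<in> {x \<in> carrier (power_group G t). shift_aut G t \<theta> x = x}" by blast
next
  fix x assume "x \<in> {x \<in> carrier (power_group G t). shift_aut G t \<theta> x = x}"
  then have x: "x \<in> {1..t} \<rightarrow>\<^sub>E carrier G" and sx: "shift_aut G t \<theta> x = x" by auto
  have fx: "x i = (if i = 1 then \<theta> (x t) else x (i - 1))" if "i \<in> {1..t}" for i
    using fun_cong[OF sx, of i] that x by (simp add: shift_aut_def)
  have eq: "x i = x 1" if "i \<in> {1..t}" for i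
    using that
  proof (induction i)
    case (Suc i)
    then show ?case using fx[of "Suc i"] by (cases "i = 0") auto
  qed simp
  have "x = (\<lambda>i\<in>{1..t}. x 1)"
  proof
    fix i show "x i = (\<lambda>i\<in>{1..t}. x 1) i"
      using eq[of i] PiE_arb[OF x, of i] by (cases "i \<in> {1..t}") simp_all
  qed
  moreover have "\<theta> (x 1) = x 1" using fx[of 1] eq[of t] assms by simp
  moreover have "x 1 \<in> carrier G" using x assms by (auto simp: PiE_iff)
  ultimately show "x \<in> diag_fix G t \<theta>" unfolding diag_fix_def by blast
qed

lemma shift_aut_auto:
  assumes "group G" "\<theta> \<in> auto G" "t \<ge> 1"
  shows "shift_aut G t \<theta> \<in> auto (power_group G t)"
proof -
  interpret group G by fact
  let ?C = "carrier (power_group G t)" and ?s = "shift_aut G t \<theta>" and ?i = "inv_into (carrier G) \<theta>"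
  let ?r = "\<lambda>x. \<lambda>i\<in>{1..t}. if i = t then ?i (x 1) else x (i + 1)"
  note inv = auto_inv_into[OF assms(1,2)]
  have hom: "\<theta> \<in> hom G G" using assms(2) by (simp add: auto_def)
  have ic: "?i a \<in> carrier G" "\<theta> a \<in> carrier G" if "a \<in> carrier G" for a
    using inv(1) hom that by (auto simp: hom_def)
  have "bij_betw ?s ?C ?C"
  proof (rule bij_betwI[where g = ?r])
    show sC: "?s \<in> ?C \<rightarrow> ?C"
    proof
      fix x assume x: "x \<in> ?C"
      then have xi: "x i \<in> carrier G" if "i \<in> {1..t}" for i using that by auto
      have "?s x i \<in> carrier G" if "i \<in> {1..t}" for i
      proof (cases "i = 1")
        case False
        then have "i - 1 \<in> {1..t}" using that by auto
        then show ?thesis using False that x xi[of "i - 1"] by (simp add: shift_aut_def)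
      qed (use that x xi[of t] ic assms(3) in \<open>simp add: shift_aut_def\<close>)
      then show "?s x \<in> ?C" using x by (auto simp: shift_aut_def)
    qed
    show rC: "?r \<in> ?C \<rightarrow> ?C"
    proof
      fix x assume x: "x \<in> ?C"
      then have "x i \<in> carrier G" if "i \<in> {1..t}" for i using that by auto
      then show "?r x \<in> ?C" using ic assms(3) by auto
    qed
    fix x assume x: "x \<in> ?C"
    then have xi: "x i \<in> carrier G" if "i \<in> {1..t}" for i using that by auto
    have xe: "x i = undefined" if "i \<notin> {1..t}" for i
      using x that PiE_arb[of x "{1..t}" "\<lambda>_. carrier G" i] by simp
    have *: "?s x \<in> ?C" "?r x \<in> ?C" using sC rC x by blast+
    show "?r (?s x) = x"
    proof
      fix i
      show "?r (?s x) i = x i"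
        using x xi[of t] xe[of i] assms(3) inv(3)[of "x t"]
        by (cases "i \<in> {1..t}"; cases "i = t"; simp_all add: shift_aut_def)
    qed
    show "?s (?r x) = x"
    proof
      fix i
      show "?s (?r x) i = x i"
        using *(2) xi[of 1] xe[of i] assms(3) inv(2)[of "x 1"]
        by (cases "i \<in> {1..t}"; cases "i = 1"; auto simp add: shift_aut_def)
    qed
  qed
  moreover have "?s \<in> hom (power_group G t) (power_group G t)"
  proof (rule homI)
    show "?s x \<in> ?C" if "x \<in> ?C" for x
      using that \<open>bij_betw ?s ?C ?C\<close> by (auto simp: bij_betw_def)
    fix x y assume xy: "x \<in> ?C" "y \<in> ?C"
    interpret P: group "power_group G t" by simp
    have xyC: "x \<otimes>\<^bsub>power_group G t\<^esub> y \<in> ?C" using P.m_closed[OF xy] .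
    have "x t \<in> carrier G" "y t \<in> carrier G" using xy assms(3) by auto
    then have h: "\<theta> (x t \<otimes>\<^bsub>G\<^esub> y t) = \<theta> (x t) \<otimes>\<^bsub>G\<^esub> \<theta> (y t)" using hom by (simp add: hom_def)
    show "?s (x \<otimes>\<^bsub>power_group G t\<^esub> y) = ?s x \<otimes>\<^bsub>power_group G t\<^esub> ?s y"
    proof
      fix i
      show "?s (x \<otimes>\<^bsub>power_group G t\<^esub> y) i = (?s x \<otimes>\<^bsub>power_group G t\<^esub> ?s y) i"
        using xy xyC h assms(3) by (cases "i \<in> {1..t}"; cases "i = 1"; auto simp: shift_aut_def)
    qed
  qed
  ultimately show ?thesis by (auto simp: auto_def Bij_def shift_aut_def)
qed

lemma quandle_power_quandle:
  assumes "group G" "\<theta> \<in> auto G" "t \<ge> 1"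
  shows "quandle (power_quandle G t \<theta>)"
proof -
  interpret P: group "power_group G t" using assms(1) by simp
  interpret s: group_hom "power_group G t" "power_group G t" "shift_aut G t \<theta>"
    using shift_aut_auto[OF assms] by unfold_locales (simp add: auto_def)
  have "subgroup (diag_fix G t \<theta>) (power_group G t)"
    unfolding diag_fix_eq[OF assms(3)]
  proof (rule P.subgroupI)
    show "{x \<in> carrier (power_group G t). shift_aut G t \<theta> x = x} \<noteq> {}"
      using s.hom_one P.one_closed by blast
  qed (use s.hom_inv s.hom_mult P.inv_closed P.m_closed in auto)
  then show ?thesis
    unfolding power_quandle_def
    using quandle_coset_quandle[OF P.is_group _ shift_aut_auto[OF assms]] diag_fix_eq[OF assms(3)]
    by blast
qed

end

theory Submission
  imports Defs
begin

text \<open>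
  All three conditions are compared with a fourth: \<open>x \<star> y = y\<close> only for \<open>x = y\<close>, i.e. every left
  translation \<open>L\<^sub>x\<close> fixes only \<open>x\<close>. In any quandle this is equivalent to being superfaithful, because
  in a faithful quandle \<open>x \<star> y = y\<close> implies \<open>y \<star> x = x\<close>, so that \<open>{x, y}\<close> is a subalgebra with trivial
  operation (\<open>superfaithful_iff_fixed_point_free\<close>). It also follows from being superconnected, because
  \<open>{z. z \<star> y = y}\<close> is a subalgebra in which \<open>y\<close> cannot be moved
  (\<open>superconnected_imp_fixed_point_free\<close>).

  In \<open>(L, t, 1)\<close> a translation with a second fixed point amounts to a tuple \<open>z\<close> outside the diagonal
  whose cyclic shift is \<open>z\<close> times a constant tuple \<open>h\<close>. Going around the cycle once gives \<open>h\<^sup>t = 1\<close>, and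
  each nontrivial solution of this equation yields such a progression. By Cauchy's theorem there is a
  nontrivial solution exactly if \<open>|L|\<close> and \<open>t\<close> have a common prime factor
  (\<open>fixed_point_free_if_coprime\<close>, \<open>coprime_if_fixed_point_free_power_quandle\<close>).

  What remains is that coprimality implies superconnectedness. The translations of a coset quandle
  lie in one coset of the permutation group \<open>N\<close> induced by left multiplication with elements of the
  group, and their \<open>t\<close>-th powers are trivial. For \<open>x\<close>, \<open>y\<close> in a subalgebra \<open>S\<close>, let \<open>K\<close> be the group
  generated by the translations by \<open>S\<close>. Since \<open>|N|\<close> is coprime to \<open>t\<close>, the permutations \<open>L\<^sub>x\<close> and \<open>L\<^sub>y\<close>
  are conjugate under \<open>N \<inter> K\<close>, by the conjugacy part of the Schur--Zassenhaus theorem for cyclic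
  quotients. That case has a short proof by counting fixed points (\<open>coprime_coset_conjugate\<close>). A
  permutation in \<open>K\<close> that conjugates \<open>L\<^sub>x\<close> to \<open>L\<^sub>y\<close> maps \<open>x\<close> to the only fixed point of \<open>L\<^sub>y\<close>, which is \<open>y\<close>
  (\<open>superconnected_if_coprime\<close>).
\<close>

section \<open>Fixed points of maps of prime period\<close>

lemma funpow_closed:
  assumes "f \<in> A \<rightarrow> A" "a \<in> A"
  shows "(f ^^ k) a \<in> A"
  using assms by (induction k) auto

text \<open>An orbit of a map with \<open>f\<^sup>p = id\<close> has size \<open>1\<close> or \<open>p\<close>. If no orbit is a single point, removing
orbits of size \<open>p\<close> one after the other shows that \<open>p\<close> divides the number of points.\<close>

lemma fixed_point_of_prime_period:
  fixes p :: nat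
  assumes "finite A" "Factorial_Ring.prime p" "f \<in> A \<rightarrow> A" "\<And>a. a \<in> A \<Longrightarrow> (f ^^ p) a = a" "\<not> p dvd card A"
  shows "\<exists>a\<in>A. f a = a"
proof (rule ccontr)
  assume "\<not> (\<exists>a\<in>A. f a = a)"
  then have nofix: "\<And>a. a \<in> A \<Longrightarrow> f a \<noteq> a" by blast
  have "p dvd card A" using assms(1,3,4) nofix
  proof (induction A rule: finite_psubset_induct)
    case (psubset A)
    show ?case
    proof (cases "A = {}")
      case False
      then obtain a where a: "a \<in> A" by blast
      let ?O = "(\<lambda>k. (f ^^ k) a) ` {..<p}"
      have p0: "p > 0" using assms(2) prime_gt_0_nat by blast
      have orb: "(f ^^ k) a \<in> ?O" for k
        using funpow_mod_eq[of p f a k] psubset.prems(2)[OF a] p0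
        by (metis imageI lessThan_iff mod_less_divisor)
      have OA: "?O \<subseteq> A" using funpow_closed[OF psubset.prems(1) a] by blast
      have neq: "(f ^^ i) a \<noteq> (f ^^ j) a" if ij: "i < j" "j < p" for i j
      proof
        assume "(f ^^ i) a = (f ^^ j) a"
        then have "(f ^^ (p - i)) ((f ^^ i) a) = (f ^^ (p - i)) ((f ^^ j) a)" by simp
        then have "(f ^^ p) a = (f ^^ (p - i + j)) a"
          using that by (simp flip: funpow_add comp_apply[of "f ^^ _" "f ^^ _"])
        moreover have "p - i + j = (j - i) + p" using that by simp
        ultimately have d: "(f ^^ (j - i)) a = a"
          using psubset.prems(2)[OF a] by (simp add: funpow_add)
        \<comment> \<open>both \<open>j - i\<close> and \<open>p\<close> are periods of \<open>a\<close>, so the combination \<open>1\<close> of the two is one as well\<close>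
        have "coprime (j - i) p" using that assms(2)
          by (metis coprime_commute dvd_imp_le less_imp_diff_less not_le prime_imp_coprime zero_less_diff)
        then obtain m l where "(j - i) * m = p * l + 1"
          using bezout_nat[of "j - i" p] ij by (auto simp: coprime_iff_gcd_eq_1)
        then have "((j - i) * m) mod p = 1"
          using prime_gt_1_nat[OF assms(2)] by (metis mod_less mod_mult_self4)
        then have "(f ^^ ((j - i) * m)) a = f a"
          using funpow_mod_eq[of p f a "(j - i) * m"] psubset.prems(2)[OF a] by simp
        moreover have "(f ^^ ((j - i) * m)) a = a"
          using funpow_mod_eq[of "j - i" f a "(j - i) * m"] d by simp
        ultimately show False using psubset.prems(3)[OF a] by simp
      qed
      have "inj_on (\<lambda>k. (f ^^ k) a) {..<p}"
        by (rule inj_onI) (metis lessThan_iff linorder_neqE_nat neq)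
      then have card: "card ?O = p" by (simp add: card_image)
      have maps: "f \<in> (A - ?O) \<rightarrow> (A - ?O)"
      proof
        fix b assume b: "b \<in> A - ?O"
        have "f b \<notin> ?O"
        proof
          assume "f b \<in> ?O"
          then obtain k where "f b = (f ^^ k) a" by blast
          then have "(f ^^ (p - 1)) (f b) = (f ^^ (p - 1 + k)) a" by (simp add: funpow_add)
          moreover have "(f ^^ (p - 1)) (f b) = b"
            using psubset.prems(2)[of b] b p0
            by (metis DiffD1 Suc_diff_1 comp_apply funpow_Suc_right)
          ultimately show False using orb b by (metis DiffD2)
        qed
        then show "f b \<in> A - ?O" using b funcset_mem[OF psubset.prems(1)] by blast
      qed
      have "A - ?O \<subset> A" using a orb[of 0] by force
      then have "p dvd card (A - ?O)"
        by (rule psubset.IH[OF _ maps]) (use psubset.prems in blast)+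
      moreover have "card A = card (A - ?O) + card ?O"
        using card_Diff_subset[OF finite_subset[OF OA psubset.hyps] OA] card_mono[OF psubset.hyps OA] by simp
      ultimately show ?thesis using card by simp
    qed simp
  qed
  with assms(5) show False ..
qed

section \<open>Conjugacy in cosets of a subgroup of coprime order\<close>

context group
begin

lemma card_subgroup_dvd:
  assumes "subgroup M G" "subgroup N G" "M \<subseteq> N"
  shows "card M dvd card N"
proof -
  interpret N: group "G\<lparr>carrier := N\<rparr>" using subgroup_imp_group[OF assms(2)] .
  have "subgroup M (G\<lparr>carrier := N\<rparr>)"
    using assms by (simp add: subgroup_incl)
  from N.lagrange[OF this] show ?thesis by (simp add: order_def) (metis dvd_triv_right)
qed

lemma cancel_left:
  assumes "x \<in> carrier G" "a \<in> carrier G"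
  shows "inv x \<otimes> (x \<otimes> a) = a" "x \<otimes> (inv x \<otimes> a) = a"
  using assms by (simp_all flip: m_assoc)

lemma pow_conjugate:
  assumes "n \<in> carrier G" "x \<in> carrier G"
  shows "(n \<otimes> x \<otimes> inv n) [^] (k::nat) = n \<otimes> x [^] k \<otimes> inv n"
proof (induction k)
  case (Suc k)
  then show ?case using assms by (simp add: m_assoc cancel_left)
qed (use assms in simp)

lemma pow_commutes:
  assumes "x \<in> carrier G"
  shows "x \<otimes> x [^] (k::nat) = x [^] k \<otimes> x"
  using assms nat_pow_Suc2 by (simp add: nat_pow_Suc)

text \<open>This is the conjugacy part of the Schur--Zassenhaus theorem for a cyclic quotient: \<open>x\<close> and \<open>y\<close>
generate complements of \<open>N\<close> in \<open>N\<langle>x\<rangle>\<close> and lie in the same coset of \<open>N\<close>. An element \<open>a\<close> of \<open>N\<close>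
conjugates \<open>x\<close> to \<open>y\<close> iff it is a fixed point of the map \<open>a \<mapsto> y a x\<^sup>-\<^sup>1\<close> on \<open>N\<close>, whose \<open>t\<close>-th iterate is
the identity; so for prime \<open>t\<close> a fixed point exists because \<open>t\<close> does not divide \<open>|N|\<close>.

For an exponent \<open>p t\<close> with \<open>p\<close> prime, the induction hypothesis applies to \<open>x\<^sup>p\<close> and \<open>y\<^sup>p\<close>. After
conjugating \<open>x\<close> within \<open>N\<close>, both have the same \<open>p\<close>-th power \<open>z\<close>, and the map above, restricted to the
centralizer of \<open>z\<close> in \<open>N\<close>, has the identity as its \<open>p\<close>-th iterate \<open>a \<mapsto> z a z\<^sup>-\<^sup>1\<close>.\<close>

lemma coprime_coset_conjugate:
  assumes "subgroup N G" "finite N" "coprime (card N) t"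
    and "x \<in> carrier G" "y \<in> carrier G" "x [^] (t::nat) = \<one>" "y [^] t = \<one>"
    and "\<And>n. n \<in> N \<Longrightarrow> x \<otimes> n \<otimes> inv x \<in> N" "y \<otimes> inv x \<in> N"
  shows "\<exists>n\<in>N. y \<otimes> n = n \<otimes> x"
  using assms
proof (induction t arbitrary: N x y rule: prime_divisors_induct)
  case zero
  interpret N: subgroup N G by (fact zero.prems(1))
  \<comment> \<open>being coprime to \<open>0\<close> means being \<open>1\<close>\<close>
  have "card N = 1" using zero.prems(3) by simp
  then have "y \<otimes> inv x = \<one>"
    using zero.prems(9) N.one_closed by (metis card_1_singletonE singletonD)
  then have "y = x" using zero.prems(4,5) by (metis inv_closed inv_equality inv_inv)
  then show ?case using zero.prems(4) N.one_closed by (metis l_one r_one)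
next
  case (unit t)
  interpret N: subgroup N G by (fact unit.prems(1))
  have "t = 1" using unit.hyps by simp
  then have "x = \<one>" "y = \<one>" using unit.prems by simp_all
  then show ?case using N.one_closed by blast
next
  case (factor p t)
  note N = \<open>subgroup N G\<close> and x = \<open>x \<in> carrier G\<close> and y = \<open>y \<in> carrier G\<close>
    and norm = factor.prems(8) and yx = factor.prems(9)
  interpret N: subgroup N G by (fact N)
  have cop: "coprime (card N) p" "coprime (card N) t" using factor.prems(3) by simp_all
  have Nc: "n \<in> carrier G" if "n \<in> N" for n using that by simp
  \<comment> \<open>the hypotheses on \<open>x\<close> and \<open>y\<close> pass to their powers\<close>
  have "x [^] k \<otimes> n \<otimes> inv (x [^] k) \<in> N" if "n \<in> N" for n and k :: nat
  proof (induction k)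
    case (Suc k)
    have "x [^] Suc k \<otimes> n \<otimes> inv (x [^] Suc k) = x \<otimes> (x [^] k \<otimes> n \<otimes> inv (x [^] k)) \<otimes> inv x"
      using x Nc[OF that] by (simp add: pow_commutes[symmetric] inv_mult_group m_assoc)
    then show ?case using norm[OF Suc] by simp
  qed (use that Nc in simp)
  moreover have "y [^] k \<otimes> inv (x [^] k) \<in> N" for k :: nat
  proof (induction k)
    case (Suc k)
    have "y [^] Suc k \<otimes> inv (x [^] Suc k)
      = (y \<otimes> inv x) \<otimes> (x \<otimes> (y [^] k \<otimes> inv (x [^] k)) \<otimes> inv x)"
      using x y by (simp add: pow_commutes[symmetric] inv_mult_group m_assoc cancel_left)
    then show ?case using norm[OF Suc] yx by simp
  qed (use N.one_closed in simp)
  moreover have "(x [^] p) [^] t = \<one>" "(y [^] p) [^] t = \<one>"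
    using factor.prems(6,7) x y by (simp_all add: nat_pow_pow)
  ultimately obtain n where n: "n \<in> N" "y [^] p \<otimes> n = n \<otimes> x [^] p"
    using factor.IH[OF N factor.prems(2) cop(2), of "x [^] p" "y [^] p"] x y by auto
  define z where "z = y [^] p"
  define x' where "x' = n \<otimes> x \<otimes> inv n"
  have c: "n \<in> carrier G" "z \<in> carrier G" "x' \<in> carrier G"
    using n Nc x y by (simp_all add: z_def x'_def)
  have x'p: "x' [^] p = z"
    unfolding x'_def z_def pow_conjugate[OF c(1) x] n(2)[symmetric]
    using c(1) y by (simp add: m_assoc cancel_left)
  define C where "C = {a \<in> N. z \<otimes> a = a \<otimes> z}"
  have Cc: "a \<in> carrier G" if "a \<in> C" for a using that Nc by (simp add: C_def)
  have C: "subgroup C G"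
  proof (rule subgroupI)
    fix a assume a: "a \<in> C"
    then have "inv a \<otimes> (z \<otimes> a) \<otimes> inv a = inv a \<otimes> (a \<otimes> z) \<otimes> inv a" by (simp add: C_def)
    then show "inv a \<in> C" using a Cc[OF a] c(2) by (simp add: C_def m_assoc cancel_left)
  next
    fix a b assume ab: "a \<in> C" "b \<in> C"
    have "z \<otimes> (a \<otimes> b) = (z \<otimes> a) \<otimes> b" using ab Cc c(2) by (simp add: m_assoc)
    also have "\<dots> = a \<otimes> (z \<otimes> b)" using ab Cc c(2) by (simp add: C_def m_assoc)
    finally show "a \<otimes> b \<in> C" using ab Cc c(2) by (simp add: C_def m_assoc)
  next
    have "\<one> \<in> C" using c(2) N.one_closed by (simp add: C_def)
    then show "C \<noteq> {}" by blast
  qed (use Cc in blast)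
  define f where "f = (\<lambda>a. y \<otimes> a \<otimes> inv x')"
  have fC: "f \<in> C \<rightarrow> C"
  proof
    fix a assume a: "a \<in> C"
    have "f a = (y \<otimes> inv x) \<otimes> (x \<otimes> (a \<otimes> n) \<otimes> inv x) \<otimes> inv n"
      using Cc[OF a] c x y
      by (simp add: f_def x'_def inv_mult_group m_assoc cancel_left)
    moreover have "a \<in> N" using a by (simp add: C_def)
    ultimately have "f a \<in> N" using norm[of "a \<otimes> n"] n(1) yx by simp
    moreover have "z \<otimes> f a = f a \<otimes> z"
    proof -
      have "z \<otimes> f a = y \<otimes> (z \<otimes> a) \<otimes> inv x'"
        using y c Cc[OF a] by (simp add: f_def z_def pow_commutes[symmetric] flip: m_assoc)
      also have "\<dots> = y \<otimes> a \<otimes> (z \<otimes> inv x')"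
        using a y c Cc[OF a] by (simp add: C_def m_assoc)
      also have "z \<otimes> inv x' = inv x' \<otimes> z"
        using pow_commutes[OF c(3), of p] c unfolding x'p
        by (metis inv_closed inv_solve_left inv_solve_right m_assoc m_closed)
      finally show ?thesis using y c Cc[OF a] by (simp add: f_def m_assoc)
    qed
    ultimately show "f a \<in> C" by (simp add: C_def)
  qed
  have "(f ^^ k) a = y [^] k \<otimes> a \<otimes> inv (x' [^] k)" if "a \<in> C" for a k
  proof (induction k)
    case (Suc k)
    then have "(f ^^ Suc k) a = y \<otimes> (y [^] k \<otimes> a \<otimes> inv (x' [^] k)) \<otimes> inv x'" by (simp add: f_def)
    then show ?case using y c Cc[OF that]
      by (simp add: pow_commutes[symmetric] inv_mult_group m_assoc)
  qed (use that Cc in simp)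
  then have "(f ^^ p) a = z \<otimes> a \<otimes> inv z" if "a \<in> C" for a
    using that by (simp add: x'p z_def)
  then have per: "(f ^^ p) a = a" if "a \<in> C" for a
    using that c Cc[OF that] by (simp add: C_def m_assoc)
  have CN: "C \<subseteq> N" by (auto simp: C_def)
  have "\<not> p dvd card C"
    using card_subgroup_dvd[OF C N CN] cop(1) factor.hyps
    by (meson coprime_absorb_right coprime_commute dvd_trans not_prime_unit)
  from fixed_point_of_prime_period[OF finite_subset[OF CN factor.prems(2)] factor.hyps fC per this]
  obtain a where a: "a \<in> C" "f a = a" by blast
  have "y \<otimes> a = a \<otimes> x'"
    using a(2) Cc[OF a(1)] y c unfolding f_def by (metis inv_solve_right m_closed)
  then have "y \<otimes> a \<otimes> n = a \<otimes> (n \<otimes> x \<otimes> inv n) \<otimes> n" by (simp add: x'_def)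
  then have "y \<otimes> (a \<otimes> n) = (a \<otimes> n) \<otimes> x"
    using y x c(1) Cc[OF a(1)] by (simp add: m_assoc)
  moreover have "a \<otimes> n \<in> N" using a(1) CN n(1) by blast
  ultimately show ?case by blast
qed

end

lemma (in group) ex_element_of_prime_order:
  assumes "finite (carrier G)" "Factorial_Ring.prime (p::nat)" "p dvd order G"
  shows "\<exists>h\<in>carrier G. h \<noteq> \<one> \<and> h [^] p = \<one>"
proof -
  obtain m where "order G = p ^ 1 * m" using assms(3) by (auto elim: dvdE)
  then obtain P where P: "subgroup P G" "card P = p ^ 1"
    using sylow_thm[OF assms(2) group_axioms _ assms(1)] by blast
  interpret P: subgroup P G by (fact P(1))
  interpret PG: group "G\<lparr>carrier := P\<rparr>" using subgroup_imp_group[OF P(1)] .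
  have "P \<noteq> {\<one>}" using P(2) prime_gt_1_nat[OF assms(2)] by auto
  then obtain h where h: "h \<in> P" "h \<noteq> \<one>" using P.one_closed by blast
  have "h [^]\<^bsub>G\<lparr>carrier := P\<rparr>\<^esub> order (G\<lparr>carrier := P\<rparr>) = \<one>"
    using PG.pow_order_eq_1 h(1) by simp
  then have "h [^] p = \<one>"
    using P(2) nat_pow_consistent[of h p P] by (simp add: order_def)
  then show ?thesis using h P.mem_carrier by blast
qed

lemma (in group) eq_one_if_coprime_pow:
  assumes "x \<in> carrier G" "x [^] (t::nat) = \<one>" "coprime (order G) t"
  shows "x = \<one>"
proof -
  have "ord x dvd 1"
    using assms ord_dvd_group_order[of x] pow_eq_id[of x t] by (metis coprime_common_divisor_nat nat_dvd_1_iff_1)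
  then show ?thesis using assms(1) ord_eq_1[of x] by simp
qed

lemma (in group_hom) card_image_dvd_order:
  "card (h ` carrier G) dvd order G"
proof -
  interpret I: group "H\<lparr>carrier := h ` carrier G\<rparr>"
    using H.subgroup_imp_group[OF img_is_subgroup] .
  interpret K: group_hom G "H\<lparr>carrier := h ` carrier G\<rparr>" h
    by unfold_locales (auto simp: hom_def)
  have "card (carrier (G Mod kernel G (H\<lparr>carrier := h ` carrier G\<rparr>) h)) = card (h ` carrier G)"
    using iso_same_card[OF K.FactGroup_iso] by simp
  then show ?thesis using G.lagrange[OF K.subgroup_kernel]
    by (simp add: FactGroup_def) (metis dvd_triv_left)
qed

section \<open>Superfaithful and superconnected quandles\<close>

text \<open>In a quandle \<open>x \<star> x = x\<close>, so this says that each left translation has as few fixed points as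
possible.\<close>

definition fixed_point_free :: "('a, 'b) lq_struct_scheme \<Rightarrow> bool"
  where "fixed_point_free Q \<longleftrightarrow>
    (\<forall>x\<in>carrier Q. \<forall>y\<in>carrier Q. x \<star>\<^bsub>Q\<^esub> y = y \<longrightarrow> x = y)"

lemma carrier_BijGroup: "carrier (BijGroup S) = Bij S"
  and one_BijGroup: "\<one>\<^bsub>BijGroup S\<^esub> = (\<lambda>x\<in>S. x)"
  by (simp_all add: BijGroup_def)

lemma BijGroup_mult_apply:
  assumes "f \<in> Bij S" "g \<in> Bij S" "a \<in> S"
  shows "(f \<otimes>\<^bsub>BijGroup S\<^esub> g) a = f (g a)"
  using assms by (simp add: BijGroup_def compose_def)

lemma Bij_closed: "f \<in> Bij S \<Longrightarrow> a \<in> S \<Longrightarrow> f a \<in> S"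
  using funcset_mem[OF Bij_imp_funcset] .

context left_quasigroup
begin

lemma left_translation_apply [simp]:
  "y \<in> carrier Q \<Longrightarrow> left_translation Q x y = x \<star> y"
  by (simp add: left_translation_def)

lemma left_translation_Bij:
  assumes "x \<in> carrier Q"
  shows "left_translation Q x \<in> Bij (carrier Q)"
proof -
  have "bij_betw (left_translation Q x) (carrier Q) (carrier Q)"
    by (rule bij_betw_byWitness[where f' = "\<lambda>y. x \<setminus> y"])
      (use assms mult_closed ldiv_closed mult_ldiv ldiv_mult in auto)
  then show ?thesis by (simp add: Bij_def left_translation_def)
qed

lemma inv_left_translation:
  assumes "x \<in> carrier Q"
  shows "inv\<^bsub>BijGroup (carrier Q)\<^esub> (left_translation Q x) = (\<lambda>y\<in>carrier Q. x \<setminus> y)"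
proof -
  have "inv_into (carrier Q) (left_translation Q x) y = x \<setminus> y" if "y \<in> carrier Q" for y
    using assms that left_translation_Bij[OF assms]
    by (intro inv_into_f_eq) (simp_all add: Bij_def bij_betw_def ldiv_closed mult_ldiv)
  then show ?thesis
    unfolding inv_BijGroup[OF left_translation_Bij[OF assms]] by (rule restrict_ext)
qed

lemma LMlt_Bij: "LMlt Q \<subseteq> Bij (carrier Q)"
proof -
  have "left_translation Q ` carrier Q \<subseteq> carrier (BijGroup (carrier Q))"
    using left_translation_Bij by (auto simp only: carrier_BijGroup)
  from group.generate_incl[OF group_BijGroup this] show ?thesis
    by (simp only: LMlt_def carrier_BijGroup)
qed

lemma left_quasigroup_subalgebra:
  assumes "subalgebra S Q"
  shows "left_quasigroup (Q\<lparr>carrier := S\<rparr>)"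
proof -
  have "S \<subseteq> carrier Q" using assms by (simp add: subalgebra_def)
  then show ?thesis
    using assms mult_ldiv ldiv_mult by unfold_locales (auto simp: subalgebra_def subset_eq)
qed

lemma subalgebra_carrier:
  assumes "carrier Q \<noteq> {}"
  shows "subalgebra (carrier Q) Q"
  using assms mult_closed ldiv_closed by (simp add: subalgebra_def)

end

context quandle
begin

lemma ldiv_fixed: "x \<in> carrier Q \<Longrightarrow> y \<in> carrier Q \<Longrightarrow> x \<star> y = y \<Longrightarrow> x \<setminus> y = y"
  using ldiv_mult[of x y] by simp

text \<open>If \<open>x \<star> y = y\<close>, then left distributivity gives \<open>L\<^bsub>y \<star> x\<^esub> = L\<^sub>x\<close>, whence \<open>y \<star> x = x\<close> by faithfulness;
so \<open>{x, y}\<close> is a subalgebra on which both translations are the identity. Conversely, if \<open>x\<close> and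
\<open>y\<close> have the same translation on some subalgebra, then \<open>x \<star> y = y \<star> y = y\<close>.\<close>

lemma superfaithful_iff_fixed_point_free: "superfaithful Q \<longleftrightarrow> fixed_point_free Q"
proof
  assume sf: "superfaithful Q"
  show "fixed_point_free Q"
    unfolding fixed_point_free_def
  proof (intro ballI impI)
    fix x y assume x: "x \<in> carrier Q" and y: "y \<in> carrier Q" and xy: "x \<star> y = y"
    have "subalgebra (carrier Q) Q" using x by (intro subalgebra_carrier) blast
    then have "faithful_lq (Q\<lparr>carrier := carrier Q\<rparr>)"
      using sf unfolding superfaithful_def by blast
    then have faithful: "inj_on (left_translation Q) (carrier Q)"
      by (simp add: faithful_lq_def)
    have "(y \<star> x) \<star> v = x \<star> v" if v: "v \<in> carrier Q" for v
    proof -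
      \<comment> \<open>every \<open>v\<close> has the form \<open>y \<star> w\<close>, and on such elements the two translations agree\<close>
      define w where "w = y \<setminus> v"
      have w: "w \<in> carrier Q" "v = y \<star> w" using v y by (simp_all add: w_def ldiv_closed mult_ldiv)
      have "(y \<star> x) \<star> (y \<star> w) = y \<star> (x \<star> w)" using left_distrib[OF y x w(1)] by simp
      also have "\<dots> = x \<star> (y \<star> w)" using left_distrib[OF x y w(1)] xy by simp
      finally show ?thesis by (simp add: w(2))
    qed
    then have "left_translation Q (y \<star> x) = left_translation Q x"
      unfolding left_translation_def by (rule restrict_ext)
    then have yx: "y \<star> x = x" by (rule inj_onD[OF faithful _ mult_closed[OF y x] x])
    have "subalgebra {x, y} Q"
      using x y xy yx idem[OF x] idem[OF y] ldiv_fixed[OF x x] ldiv_fixed[OF x y]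
        ldiv_fixed[OF y x] ldiv_fixed[OF y y]
      by (simp add: subalgebra_def)
    then have "faithful_lq (Q\<lparr>carrier := {x, y}\<rparr>)"
      using sf unfolding superfaithful_def by blast
    then have inj: "inj_on (left_translation (Q\<lparr>carrier := {x, y}\<rparr>)) {x, y}"
      by (simp add: faithful_lq_def)
    have "left_translation (Q\<lparr>carrier := {x, y}\<rparr>) x = left_translation (Q\<lparr>carrier := {x, y}\<rparr>) y"
      using xy yx idem[OF x] idem[OF y] by (auto simp: left_translation_def intro!: restrict_ext)
    then show "x = y" by (rule inj_onD[OF inj]) simp_all
  qed
next
  assume fpf: "fixed_point_free Q"
  show "superfaithful Q"
    unfolding superfaithful_def faithful_lq_def
  proof (intro allI impI inj_onI)
    fix S x y assume S: "subalgebra S Q"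
      and xy: "x \<in> carrier (Q\<lparr>carrier := S\<rparr>)" "y \<in> carrier (Q\<lparr>carrier := S\<rparr>)"
      and eq: "left_translation (Q\<lparr>carrier := S\<rparr>) x = left_translation (Q\<lparr>carrier := S\<rparr>) y"
    have c: "x \<in> carrier Q" "y \<in> carrier Q" using xy S by (auto simp: subalgebra_def)
    have "x \<star> y = y \<star> y" using fun_cong[OF eq, of y] xy by (simp add: left_translation_def)
    then have "x \<star> y = y" using idem[OF c(2)] by simp
    then show "x = y" using c fpf unfolding fixed_point_free_def by blast
  qed
qed

text \<open>The elements whose translation fixes a given \<open>y\<close> form a subalgebra, and \<open>y\<close> is a fixed point of
its left multiplication group. Connectedness leaves no room for a second element.\<close>

lemma superconnected_imp_fixed_point_free:
  assumes "superconnected Q"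
  shows "fixed_point_free Q"
  unfolding fixed_point_free_def
proof (intro ballI impI)
  fix x y assume x: "x \<in> carrier Q" and y: "y \<in> carrier Q" and xy: "x \<star> y = y"
  define S where "S = {z \<in> carrier Q. z \<star> y = y}"
  let ?R = "Q\<lparr>carrier := S\<rparr>"
  have "z \<star> w \<in> S" "z \<setminus> w \<in> S" if "z \<in> S" "w \<in> S" for z w
  proof -
    have c: "z \<in> carrier Q" "w \<in> carrier Q" "z \<star> y = y" "w \<star> y = y"
      using that by (simp_all add: S_def)
    have "(z \<star> w) \<star> y = (z \<star> w) \<star> (z \<star> y)" by (simp add: c)
    also have "\<dots> = z \<star> (w \<star> y)" using left_distrib c(1,2) y by simp
    finally show "z \<star> w \<in> S" using c mult_closed by (simp add: S_def)
    have "z \<star> ((z \<setminus> w) \<star> y) = z \<star> y"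
      using left_distrib[OF c(1) ldiv_closed[OF c(1,2)] y] c y by (simp add: mult_ldiv)
    then have "(z \<setminus> w) \<star> y = y"
      using ldiv_mult[OF c(1)] mult_closed ldiv_closed c(1,2) y by metis
    then show "z \<setminus> w \<in> S" using c ldiv_closed by (simp add: S_def)
  qed
  moreover have "x \<in> S" "y \<in> S" using x y xy idem by (simp_all add: S_def)
  ultimately have sub: "subalgebra S Q" by (auto simp: subalgebra_def S_def)
  interpret R: left_quasigroup ?R by (rule left_quasigroup_subalgebra[OF sub])
  have fix_y: "f y = y" if "f \<in> LMlt ?R" for f
    using that unfolding LMlt_def
  proof (induction rule: generate.induct)
    case one
    show ?case using \<open>y \<in> S\<close> by (simp add: one_BijGroup)
  next
    case (incl h)
    then show ?case using \<open>y \<in> S\<close> by (auto simp: S_def left_translation_def)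
  next
    case (inv h)
    then obtain z where z: "z \<in> S" "h = left_translation ?R z" by auto
    have "z \<setminus> y = y" using z(1) y ldiv_fixed by (simp add: S_def)
    then show ?case using R.inv_left_translation[of z] z \<open>y \<in> S\<close> by simp
  next
    case (eng f g)
    then have "f \<in> Bij S" "g \<in> Bij S" using R.LMlt_Bij by (auto simp: LMlt_def)
    then show ?case using eng.IH \<open>y \<in> S\<close> by (simp add: BijGroup_mult_apply)
  qed
  have "connected_lq ?R" using assms sub by (simp add: superconnected_def)
  then obtain f where f: "f \<in> LMlt ?R" "f y = x"
    using \<open>x \<in> S\<close> \<open>y \<in> S\<close> unfolding connected_lq_def by force
  show "x = y" using fix_y[OF f(1)] f(2) by simp
qed

text \<open>The group of permutations of \<open>Q\<close> generated by the translations by a subalgebra \<open>S\<close> maps onto the left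
multiplication group of \<open>S\<close>. Working in permutations of \<open>Q\<close> keeps the translations by \<open>S\<close> in one
group with a subgroup that need not preserve \<open>S\<close>. All its elements are automorphisms, because
translations are.\<close>

lemma translation_group_restrict:
  assumes S: "subalgebra S Q"
    and f: "f \<in> generate (BijGroup (carrier Q)) (left_translation Q ` S)"
  shows "f \<in> Bij (carrier Q) \<and> restrict f S \<in> LMlt (Q\<lparr>carrier := S\<rparr>) \<and>
    (\<forall>a\<in>carrier Q. \<forall>b\<in>carrier Q. f (a \<star> b) = f a \<star> f b)"
  using f
proof (induction rule: generate.induct)
  let ?B = "BijGroup (carrier Q)" and ?R = "Q\<lparr>carrier := S\<rparr>"
  interpret R: left_quasigroup ?R by (rule left_quasigroup_subalgebra[OF S])
  interpret B: group ?B by (rule group_BijGroup)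
  have SQ: "carrier Q \<inter> S = S" using S by (auto simp: subalgebra_def)
  have LM: "LMlt ?R = generate (BijGroup S) (left_translation ?R ` S)" by (simp add: LMlt_def)
  have LB: "LMlt ?R \<subseteq> Bij S" using R.LMlt_Bij by simp
  {
    case one
    have "restrict (\<lambda>x\<in>carrier Q. x) S = \<one>\<^bsub>BijGroup S\<^esub>"
      by (simp add: one_BijGroup SQ)
    then have "restrict (\<lambda>x\<in>carrier Q. x) S \<in> LMlt ?R"
      unfolding LM by (simp only: generate.one)
    moreover have "(\<lambda>x\<in>carrier Q. x) (a \<star> b) = (\<lambda>x\<in>carrier Q. x) a \<star> (\<lambda>x\<in>carrier Q. x) b"
      if "a \<in> carrier Q" "b \<in> carrier Q" for a b
      using that mult_closed by simp
    ultimately show ?case unfolding one_BijGroup by (intro conjI ballI id_Bij)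
  next
    case (incl h)
    then obtain x where "x \<in> S" "h = left_translation Q x" by (elim imageE)
    with SQ have x: "x \<in> S" "x \<in> carrier Q" "h = left_translation Q x" by auto
    have "restrict h S = left_translation ?R x"
      by (simp add: left_translation_def x(3) SQ)
    moreover have "left_translation ?R x \<in> LMlt ?R"
      unfolding LM using x(1) by (intro generate.incl imageI)
    moreover have "h (a \<star> b) = h a \<star> h b" if "a \<in> carrier Q" "b \<in> carrier Q" for a b
      using left_distrib[OF x(2) that] mult_closed that by (simp add: x(3))
    moreover have "h \<in> Bij (carrier Q)" using left_translation_Bij[OF x(2)] x(3) by simp
    ultimately show ?case by simp
  next
    case (inv h)
    then obtain x where "x \<in> S" "h = left_translation Q x" by (elim imageE)
    with SQ have x: "x \<in> S" "x \<in> carrier Q" "h = left_translation Q x" by auto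
    have h: "inv\<^bsub>?B\<^esub> h = (\<lambda>y\<in>carrier Q. x \<setminus> y)" using x inv_left_translation by simp
    have "restrict (inv\<^bsub>?B\<^esub> h) S = inv\<^bsub>BijGroup S\<^esub> (left_translation ?R x)"
      using x(1) R.inv_left_translation[of x] by (simp add: h SQ)
    then have "restrict (inv\<^bsub>?B\<^esub> h) S \<in> LMlt ?R"
      unfolding LM using x(1) by (simp only: generate.inv imageI)
    moreover have "inv\<^bsub>?B\<^esub> h \<in> Bij (carrier Q)"
      using B.inv_closed[of h] x left_translation_Bij by (simp add: carrier_BijGroup)
    moreover have "x \<setminus> (a \<star> b) = (x \<setminus> a) \<star> (x \<setminus> b)" if "a \<in> carrier Q" "b \<in> carrier Q" for a b
    proof -
      have c: "x \<setminus> a \<in> carrier Q" "x \<setminus> b \<in> carrier Q" using ldiv_closed x that by simp_all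
      have "x \<star> ((x \<setminus> a) \<star> (x \<setminus> b)) = a \<star> b"
        using left_distrib[OF x(2) c] mult_ldiv x that by simp
      then show ?thesis using ldiv_mult[OF x(2) mult_closed[OF c]] by simp
    qed
    then have "(inv\<^bsub>?B\<^esub> h) (a \<star> b) = (inv\<^bsub>?B\<^esub> h) a \<star> (inv\<^bsub>?B\<^esub> h) b"
      if "a \<in> carrier Q" "b \<in> carrier Q" for a b
      using that mult_closed by (simp add: h)
    ultimately show ?case by blast
  next
    case (eng f g)
    have fg: "f \<in> Bij (carrier Q)" "g \<in> Bij (carrier Q)"
      "restrict f S \<in> Bij S" "restrict g S \<in> Bij S"
      using eng.IH LB by blast+
    have "restrict (f \<otimes>\<^bsub>?B\<^esub> g) S = restrict f S \<otimes>\<^bsub>BijGroup S\<^esub> restrict g S"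
    proof (rule extensionalityI)
      fix a assume a: "a \<in> S"
      then have "a \<in> carrier Q" "g a \<in> S" using SQ Bij_closed[OF fg(4) a] by auto
      then show "restrict (f \<otimes>\<^bsub>?B\<^esub> g) S a = (restrict f S \<otimes>\<^bsub>BijGroup S\<^esub> restrict g S) a"
        using a fg by (simp add: BijGroup_mult_apply)
    qed (use fg(3,4) in \<open>simp_all add: BijGroup_def compose_def\<close>)
    then have "restrict (f \<otimes>\<^bsub>?B\<^esub> g) S \<in> LMlt ?R"
      using eng.IH unfolding LM by (simp only: generate.eng)
    moreover have "f \<otimes>\<^bsub>?B\<^esub> g \<in> Bij (carrier Q)"
      using fg(1,2) B.m_closed by (simp add: carrier_BijGroup)
    moreover have "(f \<otimes>\<^bsub>?B\<^esub> g) (a \<star> b) = (f \<otimes>\<^bsub>?B\<^esub> g) a \<star> (f \<otimes>\<^bsub>?B\<^esub> g) b"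
      if ab: "a \<in> carrier Q" "b \<in> carrier Q" for a b
      using eng.IH ab mult_closed[OF ab] Bij_closed[OF fg(2) ab(1)] Bij_closed[OF fg(2) ab(2)]
      by (simp add: BijGroup_mult_apply[OF fg(1,2)])
    ultimately show ?case by blast
  }
qed

text \<open>Let \<open>K\<close> be generated by the translations by a subalgebra \<open>S\<close>. For \<open>x\<close>, \<open>y\<close> in \<open>S\<close> the translations
\<open>L\<^sub>x\<close> and \<open>L\<^sub>y\<close> lie in the same coset of \<open>N \<inter> K\<close>, which has order coprime to their exponent \<open>t\<close>.
Hence some \<open>n\<close> in \<open>N \<inter> K\<close> satisfies \<open>L\<^sub>y n = n L\<^sub>x\<close>, and evaluation at \<open>x\<close> gives
\<open>y \<star> n x = n (x \<star> x) = n x\<close>. Therefore \<open>n x = y\<close>, and \<open>n\<close> acts on \<open>S\<close> as an element of its left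
multiplication group.\<close>

theorem superconnected_if_coprime:
  fixes t :: nat
  defines "B \<equiv> BijGroup (carrier Q)"
  assumes fpf: "fixed_point_free Q"
    and N: "subgroup N B" "finite N" "coprime (card N) t"
    and period: "\<And>x. x \<in> carrier Q \<Longrightarrow> left_translation Q x [^]\<^bsub>B\<^esub> t = \<one>\<^bsub>B\<^esub>"
    and norm: "\<And>x n. x \<in> carrier Q \<Longrightarrow> n \<in> N \<Longrightarrow>
      \<exists>m\<in>N. left_translation Q x \<otimes>\<^bsub>B\<^esub> n = m \<otimes>\<^bsub>B\<^esub> left_translation Q x"
    and coset: "\<And>x y. x \<in> carrier Q \<Longrightarrow> y \<in> carrier Q \<Longrightarrow>
      \<exists>n\<in>N. left_translation Q y = n \<otimes>\<^bsub>B\<^esub> left_translation Q x"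
  shows "superconnected Q"
  unfolding superconnected_def connected_lq_def
proof (intro allI impI ballI)
  fix S x y assume S: "subalgebra S Q"
    and "x \<in> carrier (Q\<lparr>carrier := S\<rparr>)" "y \<in> carrier (Q\<lparr>carrier := S\<rparr>)"
  then have xS: "x \<in> S" and yS: "y \<in> S" and x: "x \<in> carrier Q" and y: "y \<in> carrier Q"
    by (auto simp: subalgebra_def)
  interpret B: group B unfolding B_def by (rule group_BijGroup)
  have SQ: "S \<subseteq> carrier Q" using S by (simp add: subalgebra_def)
  have cB: "carrier B = Bij (carrier Q)" by (simp add: B_def carrier_BijGroup)
  let ?L = "left_translation Q"
  have L: "?L z \<in> carrier B" if "z \<in> carrier Q" for z
    using left_translation_Bij[OF that] by (simp add: cB)
  define K where "K = generate B (?L ` S)"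
  have "subgroup K B" unfolding K_def using L SQ by (intro B.generate_is_subgroup) blast
  then interpret K: subgroup K B .
  interpret N: subgroup N B by (fact N(1))
  have LK: "?L z \<in> K" if "z \<in> S" for z using that by (simp add: K_def generate.incl)
  have NK: "subgroup (N \<inter> K) B" using N(1) \<open>subgroup K B\<close> by (rule B.subgroups_Inter_pair)
  have cop: "coprime (card (N \<inter> K)) t"
    using B.card_subgroup_dvd[OF NK N(1)] N(3) by (meson coprime_divisors dvd_refl inf_le1)
  have "?L x \<otimes>\<^bsub>B\<^esub> n \<otimes>\<^bsub>B\<^esub> inv\<^bsub>B\<^esub> (?L x) \<in> N \<inter> K" if n: "n \<in> N \<inter> K" for n
  proof -
    obtain m where m: "m \<in> N" "?L x \<otimes>\<^bsub>B\<^esub> n = m \<otimes>\<^bsub>B\<^esub> ?L x" using norm[OF x] n by blast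
    then have "?L x \<otimes>\<^bsub>B\<^esub> n \<otimes>\<^bsub>B\<^esub> inv\<^bsub>B\<^esub> (?L x) = m" using L[OF x] by (simp add: B.m_assoc)
    then show ?thesis using m(1) n LK[OF xS] by auto
  qed
  moreover have "?L y \<otimes>\<^bsub>B\<^esub> inv\<^bsub>B\<^esub> (?L x) \<in> N \<inter> K"
  proof -
    obtain n where n: "n \<in> N" "?L y = n \<otimes>\<^bsub>B\<^esub> ?L x" using coset[OF x y] by blast
    then have "?L y \<otimes>\<^bsub>B\<^esub> inv\<^bsub>B\<^esub> (?L x) = n" using L[OF x] by (simp add: B.m_assoc)
    then show ?thesis using n(1) LK xS yS by auto
  qed
  ultimately obtain n where n: "n \<in> N \<inter> K" "?L y \<otimes>\<^bsub>B\<^esub> n = n \<otimes>\<^bsub>B\<^esub> ?L x"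
    using B.coprime_coset_conjugate[OF NK _ cop L[OF x] L[OF y] period[OF x] period[OF y]] N(2)
    by auto
  have "n \<in> generate (BijGroup (carrier Q)) (?L ` S)" using n(1) by (simp add: K_def B_def)
  note n' = translation_group_restrict[OF S this]
  have nx: "n x \<in> carrier Q" using n' x by (simp add: Bij_closed)
  have "y \<star> n x = (?L y \<otimes>\<^bsub>B\<^esub> n) x" "n (x \<star> x) = (n \<otimes>\<^bsub>B\<^esub> ?L x) x"
    using n' x y nx left_translation_Bij unfolding B_def
    by (simp_all add: BijGroup_mult_apply)
  then have "y \<star> n x = n x" using n(2) idem[OF x] by simp
  then have "y = n x" using fpf y nx unfolding fixed_point_free_def by blast
  then have "restrict n S x = y" using xS by simp
  moreover have "restrict n S \<in> LMlt (Q\<lparr>carrier := S\<rparr>)"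
    by (rule conjunct1[OF conjunct2[OF n']])
  ultimately show "\<exists>f\<in>LMlt (Q\<lparr>carrier := S\<rparr>). f x = y"
    by (intro bexI[of _ "restrict n S"])
qed

end

section \<open>Coset quandles of automorphisms of finite order\<close>

lemma (in group) l_coset_eq_iff:
  assumes "subgroup H G" "x \<in> carrier G" "y \<in> carrier G"
  shows "x <# H = y <# H \<longleftrightarrow> inv x \<otimes> y \<in> H"
proof
  interpret H: subgroup H G by fact
  assume "x <# H = y <# H"
  moreover have "y \<in> y <# H" using assms H.one_closed unfolding l_coset_def by force
  ultimately obtain h where "h \<in> H" "y = x \<otimes> h" by (auto simp: l_coset_def)
  then show "inv x \<otimes> y \<in> H" using assms by (simp add: cancel_left)
next
  interpret H: subgroup H G by fact
  assume h: "inv x \<otimes> y \<in> H"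
  have "y <# H = (x \<otimes> (inv x \<otimes> y)) <# H" using assms by (simp add: cancel_left)
  also have "\<dots> = x <# ((inv x \<otimes> y) <# H)" using assms H.subset by (simp add: lcos_m_assoc)
  also have "(inv x \<otimes> y) <# H = H" using coset_join3[OF _ assms(1) h] assms by simp
  finally show "x <# H = y <# H" ..
qed

text \<open>The stabilizer \<open>H\<close> is taken to be the full fixed subgroup of \<open>\<theta>\<close>, the largest choice that a coset
quandle admits.\<close>

locale periodic_coset_quandle = group G for G (structure) +
  fixes \<theta> :: "'a \<Rightarrow> 'a" and H :: "'a set" and t :: nat
  assumes aut: "\<theta> \<in> auto G"
    and H_fixed: "H = {x \<in> carrier G. \<theta> x = x}"
    and period: "x \<in> carrier G \<Longrightarrow> (\<theta> ^^ t) x = x"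
begin

abbreviation Q where "Q \<equiv> coset_quandle G H \<theta>"

sublocale theta: group_hom G G \<theta>
  using aut by unfold_locales (simp add: auto_def)

lemma subgroup_H: "subgroup H G"
  unfolding H_fixed
proof (rule subgroupI)
  show "{x \<in> carrier G. \<theta> x = x} \<noteq> {}" using theta.hom_one one_closed by blast
qed auto

sublocale H: subgroup H G by (rule subgroup_H)

lemma H_iff: "x \<in> H \<longleftrightarrow> x \<in> carrier G \<and> \<theta> x = x"
  unfolding H_fixed by blast

lemma quandle_Q: "quandle Q"
  using quandle_coset_quandle[OF group_axioms subgroup_H aut] H_fixed by blast

sublocale Q: quandle Q by (rule quandle_Q)

lemma carrier_Q: "carrier Q = {x <# H | x. x \<in> carrier G}"
  by (auto simp: coset_quandle_def LCOSETS_def)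

lemma coset_in_Q: "x \<in> carrier G \<Longrightarrow> x <# H \<in> carrier Q"
  by (auto simp: carrier_Q)

lemma Q_mult:
  assumes "x \<in> carrier G" "y \<in> carrier G"
  shows "(x <# H) \<star>\<^bsub>Q\<^esub> (y <# H) = (x \<otimes> \<theta> (inv x \<otimes> y)) <# H"
  by (rule coset_quandle_mult[OF group_axioms subgroup_H aut _ assms]) (use H_fixed in blast)

lemma fixed_iff:
  assumes "x \<in> carrier G" "y \<in> carrier G"
  shows "(x <# H) \<star>\<^bsub>Q\<^esub> (y <# H) = y <# H \<longleftrightarrow> inv (inv x \<otimes> y) \<otimes> \<theta> (inv x \<otimes> y) \<in> H"
proof -
  have "y <# H = (x \<otimes> \<theta> (inv x \<otimes> y)) <# H \<longleftrightarrow> inv y \<otimes> (x \<otimes> \<theta> (inv x \<otimes> y)) \<in> H"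
    using assms by (intro l_coset_eq_iff[OF subgroup_H]) (simp_all del: theta.hom_mult)
  moreover have "inv y \<otimes> (x \<otimes> \<theta> (inv x \<otimes> y)) = inv (inv x \<otimes> y) \<otimes> \<theta> (inv x \<otimes> y)"
    using assms by (simp add: inv_mult_group m_assoc del: theta.hom_mult)
  ultimately show ?thesis using Q_mult[OF assms] by metis
qed

text \<open>If \<open>\<theta> z = z h\<close> with \<open>h\<close> fixed by \<open>\<theta>\<close>, then \<open>\<theta>\<^sup>k z = z h\<^sup>k\<close>. So \<open>h\<^sup>t = 1\<close>, which forces \<open>h = 1\<close> when \<open>t\<close>
is coprime to the group order, and \<open>z\<close> is then itself in \<open>H\<close>.\<close>

lemma fixed_point_free_if_coprime:
  assumes "coprime (order G) t"
  shows "fixed_point_free Q"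
  unfolding fixed_point_free_def
proof (intro ballI impI)
  fix A B assume "A \<in> carrier Q" "B \<in> carrier Q" and AB: "A \<star>\<^bsub>Q\<^esub> B = B"
  then obtain x y where xy: "x \<in> carrier G" "y \<in> carrier G" "A = x <# H" "B = y <# H"
    by (auto simp: carrier_Q)
  define z where "z = inv x \<otimes> y"
  define h where "h = inv z \<otimes> \<theta> z"
  have z: "z \<in> carrier G" using xy by (simp add: z_def)
  have h: "h \<in> H" using fixed_iff[OF xy(1,2)] AB xy(3,4) by (simp add: z_def h_def)
  then have hc: "h \<in> carrier G" "\<theta> h = h" unfolding H_iff by blast+
  have zh: "\<theta> z = z \<otimes> h" using z by (simp add: h_def cancel_left)
  have "(\<theta> ^^ k) z = z \<otimes> h [^] k" for k
  proof (induction k)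
    case (Suc k)
    have "\<theta> (h [^] k) = h [^] k" using theta.hom_nat_pow[OF hc(1), of k] hc(2) by simp
    then show ?case using Suc z hc(1) zh pow_commutes[OF hc(1), of k] by (simp add: m_assoc)
  qed (use z in simp)
  then have "z \<otimes> h [^] t = z" using period[OF z] by simp
  then have "h [^] t = \<one>" using l_cancel_one[OF z nat_pow_closed[OF hc(1)]] by simp
  then have "h = \<one>" by (rule eq_one_if_coprime_pow[OF hc(1) _ assms])
  then have "z \<in> H" using zh z unfolding H_iff by simp
  then show "A = B" using l_coset_eq_iff[OF subgroup_H xy(1,2)] xy(3,4) by (simp add: z_def)
qed

text \<open>An equation \<open>\<theta> z = z c\<close> with \<open>c\<close> in \<open>H\<close> says that the translation by the coset \<open>H\<close> fixes \<open>zH\<close>. This is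
the obstruction used below when \<open>t\<close> and the group order have a common prime factor.\<close>

lemma defect_trivial_if_fixed_point_free:
  assumes fpf: "fixed_point_free Q"
    and z: "z \<in> carrier G" and c: "c \<in> H" and zc: "\<theta> z = z \<otimes> c"
  shows "c = \<one>"
proof -
  have cG: "c \<in> carrier G" using c by (rule H.mem_carrier)
  have "inv z \<otimes> \<theta> z = c" using z cG zc by (simp add: cancel_left)
  then have "(\<one> <# H) \<star>\<^bsub>Q\<^esub> (z <# H) = z <# H"
    using fixed_iff[OF one_closed z] z c by simp
  then have "\<one> <# H = z <# H"
    using fpf coset_in_Q[OF one_closed] coset_in_Q[OF z] unfolding fixed_point_free_def by blast
  then have "z \<in> H" using l_coset_eq_iff[OF subgroup_H one_closed z] z by simp
  then have "z \<otimes> c = z" using zc unfolding H_iff by simp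
  then show ?thesis using l_cancel_one[OF z cG] by simp
qed

definition coset_shift :: "'a \<Rightarrow> 'a set \<Rightarrow> 'a set"
  where "coset_shift g = (\<lambda>A\<in>carrier Q. g <# A)"

lemma coset_shift_apply:
  "g \<in> carrier G \<Longrightarrow> x \<in> carrier G \<Longrightarrow> coset_shift g (x <# H) = (g \<otimes> x) <# H"
  by (simp add: coset_shift_def coset_in_Q lcos_m_assoc H.subset)

lemma coset_shift_Bij:
  assumes "g \<in> carrier G"
  shows "coset_shift g \<in> Bij (carrier Q)"
proof -
  have "coset_shift a (x <# H) \<in> carrier Q"
    and "coset_shift (inv a) (coset_shift a (x <# H)) = x <# H"
    if "a \<in> carrier G" "x \<in> carrier G" for a x
    using that by (simp_all add: coset_shift_apply coset_in_Q cancel_left)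
  note 1 = this
  have "bij_betw (coset_shift g) (carrier Q) (carrier Q)"
  proof (rule bij_betw_byWitness[where f' = "coset_shift (inv g)"])
    show "\<forall>A\<in>carrier Q. coset_shift (inv g) (coset_shift g A) = A"
      using 1(2)[OF assms] by (auto simp: carrier_Q)
    show "\<forall>A\<in>carrier Q. coset_shift g (coset_shift (inv g) A) = A"
      using 1(2)[of "inv g"] assms by (auto simp: carrier_Q)
    show "coset_shift g ` carrier Q \<subseteq> carrier Q"
      using 1(1)[OF assms] by (auto simp: carrier_Q)
    show "coset_shift (inv g) ` carrier Q \<subseteq> carrier Q"
      using 1(1)[of "inv g"] assms by (auto simp: carrier_Q)
  qed
  then show ?thesis by (simp add: Bij_def coset_shift_def)
qed

lemma BijGroup_Q_eqI:
  assumes "f \<in> Bij (carrier Q)" "g \<in> Bij (carrier Q)"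
    and "\<And>x. x \<in> carrier G \<Longrightarrow> f (x <# H) = g (x <# H)"
  shows "f = g"
proof (rule extensionalityI)
  show "f \<in> extensional (carrier Q)" "g \<in> extensional (carrier Q)"
    using assms(1,2) by (simp_all add: Bij_def)
  fix A assume "A \<in> carrier Q"
  then show "f A = g A" using assms(3) carrier_Q by auto
qed

sublocale shift: group_hom G "BijGroup (carrier Q)" coset_shift
proof (intro group_hom.intro group_hom_axioms.intro homI)
  interpret B: group "BijGroup (carrier Q)" by (rule group_BijGroup)
  show "group G" "group (BijGroup (carrier Q))" by (rule group_axioms group_BijGroup)+
  fix g h assume gh: "g \<in> carrier G" "h \<in> carrier G"
  then show "coset_shift g \<in> carrier (BijGroup (carrier Q))"
    by (simp add: carrier_BijGroup coset_shift_Bij)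
  have s: "coset_shift g \<in> Bij (carrier Q)" "coset_shift h \<in> Bij (carrier Q)"
    using gh by (simp_all add: coset_shift_Bij)
  then have "coset_shift g \<otimes>\<^bsub>BijGroup (carrier Q)\<^esub> coset_shift h \<in> Bij (carrier Q)"
    using B.m_closed by (simp add: carrier_BijGroup)
  then show "coset_shift (g \<otimes> h) = coset_shift g \<otimes>\<^bsub>BijGroup (carrier Q)\<^esub> coset_shift h"
    using gh s by (intro BijGroup_Q_eqI coset_shift_Bij)
      (simp_all add: BijGroup_mult_apply coset_in_Q coset_shift_apply m_assoc)
qed

lemma left_translation_power:
  assumes "x \<in> carrier G" "y \<in> carrier G"
  shows "(left_translation Q (x <# H) [^]\<^bsub>BijGroup (carrier Q)\<^esub> k) (y <# H)
    = (x \<otimes> (\<theta> ^^ k) (inv x \<otimes> y)) <# H"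
  using assms(2)
proof (induction k arbitrary: y)
  case 0
  then show ?case using assms(1) by (simp add: one_BijGroup coset_in_Q cancel_left)
next
  case (Suc k)
  let ?L = "left_translation Q (x <# H)"
  have L: "?L \<in> Bij (carrier Q)" by (rule Q.left_translation_Bij[OF coset_in_Q[OF assms(1)]])
  have Lk: "?L [^]\<^bsub>BijGroup (carrier Q)\<^esub> k \<in> Bij (carrier Q)"
    using shift.H.nat_pow_closed[of ?L k] L by (simp add: carrier_BijGroup)
  define w where "w = \<theta> (inv x \<otimes> y)"
  have w: "w \<in> carrier G" using assms(1) Suc.prems by (simp add: w_def)
  have "(?L [^]\<^bsub>BijGroup (carrier Q)\<^esub> Suc k) (y <# H)
      = (?L [^]\<^bsub>BijGroup (carrier Q)\<^esub> k) (?L (y <# H))"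
    using BijGroup_mult_apply[OF Lk L coset_in_Q[OF Suc.prems]] by simp
  also have "?L (y <# H) = (x \<otimes> w) <# H"
    using Q_mult[OF assms(1) Suc.prems] coset_in_Q[OF Suc.prems] by (simp add: w_def)
  also have "(?L [^]\<^bsub>BijGroup (carrier Q)\<^esub> k) \<dots> = (x \<otimes> (\<theta> ^^ k) w) <# H"
    using Suc.IH[of "x \<otimes> w"] assms(1) w by (simp add: cancel_left)
  also have "(\<theta> ^^ k) w = (\<theta> ^^ Suc k) (inv x \<otimes> y)" by (simp add: w_def funpow_swap1)
  finally show ?case .
qed

text \<open>The image \<open>N\<close> of \<open>G\<close> in the permutations of \<open>G/H\<close> has order dividing \<open>|G|\<close>. The translation by \<open>xH\<close>
is \<open>\<theta>\<close> followed by left multiplication by \<open>x \<theta>(x)\<^sup>-\<^sup>1\<close>, so all translations lie in one coset of \<open>N\<close>,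
normalize \<open>N\<close>, and have exponent \<open>t\<close>.\<close>

theorem superconnected_if_coprime_order:
  assumes fin: "finite (carrier G)" and cop: "coprime (order G) t"
  shows "superconnected Q"
proof (rule Q.superconnected_if_coprime)
  let ?B = "BijGroup (carrier Q)" and ?L = "left_translation Q"
  let ?N = "coset_shift ` carrier G"
  show "fixed_point_free Q" using cop by (rule fixed_point_free_if_coprime)
  show "subgroup ?N ?B" by (rule shift.img_is_subgroup)
  show "finite ?N" using fin by simp
  show "coprime (card ?N) t"
    by (rule coprime_divisors[OF shift.card_image_dvd_order dvd_refl cop])
  have mult: "f \<otimes>\<^bsub>?B\<^esub> g \<in> Bij (carrier Q)" if "f \<in> Bij (carrier Q)" "g \<in> Bij (carrier Q)" for f g
    using shift.H.m_closed that by (simp add: carrier_BijGroup)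
  have LB: "?L (x <# H) \<in> Bij (carrier Q)" if "x \<in> carrier G" for x
    using that by (intro Q.left_translation_Bij coset_in_Q)
  have La: "?L (x <# H) (y <# H) = (x \<otimes> \<theta> (inv x \<otimes> y)) <# H"
    if "x \<in> carrier G" "y \<in> carrier G" for x y
    using that by (simp add: coset_in_Q Q_mult del: theta.hom_mult)
  fix A assume "A \<in> carrier Q"
  then obtain x where x: "x \<in> carrier G" "A = x <# H" by (auto simp: carrier_Q)
  show "?L A [^]\<^bsub>?B\<^esub> t = \<one>\<^bsub>?B\<^esub>"
  proof (rule BijGroup_Q_eqI)
    show "?L A [^]\<^bsub>?B\<^esub> t \<in> Bij (carrier Q)"
      using shift.H.nat_pow_closed[of "?L A" t] LB x by (simp add: carrier_BijGroup)
    show "\<one>\<^bsub>?B\<^esub> \<in> Bij (carrier Q)" using shift.H.one_closed by (simp add: carrier_BijGroup)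
    fix y assume y: "y \<in> carrier G"
    show "(?L A [^]\<^bsub>?B\<^esub> t) (y <# H) = \<one>\<^bsub>?B\<^esub> (y <# H)"
      using left_translation_power[OF x(1) y, of t] period[of "inv x \<otimes> y"] x y
      by (simp add: one_BijGroup coset_in_Q cancel_left)
  qed
  show "\<exists>m\<in>?N. ?L A \<otimes>\<^bsub>?B\<^esub> n = m \<otimes>\<^bsub>?B\<^esub> ?L A" if "n \<in> ?N" for n
  proof -
    obtain g where g: "g \<in> carrier G" "n = coset_shift g" using \<open>n \<in> ?N\<close> by blast
    \<comment> \<open>the conjugate of left multiplication by \<open>g\<close> under the translation by \<open>xH\<close> is left multiplication by \<open>d\<close>\<close>
    define d where "d = x \<otimes> \<theta> (inv x \<otimes> g \<otimes> x) \<otimes> inv x"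
    have d: "d \<in> carrier G" using x(1) g(1) by (simp add: d_def)
    have "?L A \<otimes>\<^bsub>?B\<^esub> coset_shift g = coset_shift d \<otimes>\<^bsub>?B\<^esub> ?L A"
    proof (rule BijGroup_Q_eqI)
      fix y assume y: "y \<in> carrier G"
      have "x \<otimes> \<theta> (inv x \<otimes> (g \<otimes> y)) = d \<otimes> (x \<otimes> \<theta> (inv x \<otimes> y))"
        using x(1) g(1) y by (simp add: d_def m_assoc cancel_left)
      then show "(?L A \<otimes>\<^bsub>?B\<^esub> coset_shift g) (y <# H) = (coset_shift d \<otimes>\<^bsub>?B\<^esub> ?L A) (y <# H)"
        using x g y d LB[OF x(1)]
        by (simp add: BijGroup_mult_apply coset_shift_Bij coset_in_Q coset_shift_apply La
            del: theta.hom_mult Q.left_translation_apply)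
    qed (use x g d LB in \<open>simp_all add: mult coset_shift_Bij\<close>)
    then show ?thesis using d g(2) by blast
  qed
  show "\<exists>n\<in>?N. ?L B = n \<otimes>\<^bsub>?B\<^esub> ?L A" if "B \<in> carrier Q" for B
  proof -
    obtain y where y: "y \<in> carrier G" "B = y <# H" using \<open>B \<in> carrier Q\<close> by (auto simp: carrier_Q)
    \<comment> \<open>\<open>d\<close> is the quotient of \<open>y \<theta>(y)\<^sup>-\<^sup>1\<close> by \<open>x \<theta>(x)\<^sup>-\<^sup>1\<close>\<close>
    define d where "d = y \<otimes> \<theta> (inv y \<otimes> x) \<otimes> inv x"
    have d: "d \<in> carrier G" using x y by (simp add: d_def)
    have "?L B = coset_shift d \<otimes>\<^bsub>?B\<^esub> ?L A"
    proof (rule BijGroup_Q_eqI)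
      fix z assume z: "z \<in> carrier G"
      have "y \<otimes> \<theta> (inv y \<otimes> z) = d \<otimes> (x \<otimes> \<theta> (inv x \<otimes> z))"
        using x y z by (simp add: d_def m_assoc cancel_left)
      then show "?L B (z <# H) = (coset_shift d \<otimes>\<^bsub>?B\<^esub> ?L A) (z <# H)"
        using x y z d LB[OF x(1)]
        by (simp add: BijGroup_mult_apply coset_shift_Bij coset_in_Q coset_shift_apply La
            del: theta.hom_mult Q.left_translation_apply)
    qed (use x y d LB in \<open>simp_all add: mult coset_shift_Bij\<close>)
    then show ?thesis using d by blast
  qed
qed

end

section \<open>Powers of a group with cyclic shift\<close>

lemma shift_aut_id_apply:
  assumes "x \<in> carrier (power_group L t)" "i \<in> {1..t}"
  shows "shift_aut L t (\<lambda>x\<in>carrier L. x) x i = (if i = 1 then x t else x (i - 1))"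
proof -
  have "x t \<in> carrier L" using assms by (auto simp: PiE_iff)
  then show ?thesis using assms by (simp add: shift_aut_def)
qed

lemma funpow_shift_aut_id:
  fixes L :: "('a, 'b) monoid_scheme" and t :: nat
  defines "s \<equiv> shift_aut L t (\<lambda>x\<in>carrier L. x)"
  assumes L: "group L" and x: "x \<in> carrier (power_group L t)"
    and "k \<le> t" "i \<in> {1..t}"
  shows "(s ^^ k) x i = (if i \<le> k then x (t + i - k) else x (i - k))"
  using assms(4,5)
proof (induction k arbitrary: i)
  case (Suc k)
  have "s \<in> auto (power_group L t)"
    using shift_aut_auto[OF L group.id_in_auto[OF L]] Suc.prems unfolding s_def by simp
  then have "s \<in> carrier (power_group L t) \<rightarrow> carrier (power_group L t)"
    unfolding auto_def hom_def by blast
  then have "(s ^^ k) x \<in> carrier (power_group L t)" using x by (rule funpow_closed)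
  then have step: "(s ^^ Suc k) x i = (if i = 1 then (s ^^ k) x t else (s ^^ k) x (i - 1))"
    using shift_aut_id_apply[where L = L and t = t and i = i] Suc.prems(2) unfolding s_def
    by (simp only: funpow.simps comp_apply)
  show ?case
  proof (cases "i = 1")
    case True
    then show ?thesis using step Suc.IH[of t] Suc.prems by simp
  next
    case False
    then have "i - 1 \<in> {1..t}" using Suc.prems(2) by auto
    then show ?thesis using False step Suc.IH[of "i - 1"] Suc.prems by auto
  qed
qed simp

lemma periodic_coset_quandle_power:
  assumes L: "group L" and t: "t \<ge> 1"
  shows "periodic_coset_quandle (power_group L t) (shift_aut L t (\<lambda>x\<in>carrier L. x))
    (diag_fix L t (\<lambda>x\<in>carrier L. x)) t"
proof (intro periodic_coset_quandle.intro periodic_coset_quandle_axioms.intro)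
  let ?s = "shift_aut L t (\<lambda>x\<in>carrier L. x)"
  show "group (power_group L t)" using L by simp
  show aut: "?s \<in> auto (power_group L t)"
    using shift_aut_auto[OF L group.id_in_auto[OF L] t] .
  show "diag_fix L t (\<lambda>x\<in>carrier L. x) = {x \<in> carrier (power_group L t). ?s x = x}"
    by (rule diag_fix_eq[OF t])
  fix x assume x: "x \<in> carrier (power_group L t)"
  have "?s \<in> carrier (power_group L t) \<rightarrow> carrier (power_group L t)"
    using aut unfolding auto_def hom_def by blast
  then have "(?s ^^ t) x \<in> carrier (power_group L t)" using x by (rule funpow_closed)
  then show "(?s ^^ t) x = x"
    using x funpow_shift_aut_id[OF L x order_refl]
    by (intro PiE_ext[where k = "{1..t}" and s = "\<lambda>_. carrier L"]) simp_all
qed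

lemma finite_power_group:
  assumes "finite (carrier L)"
  shows "finite (carrier (power_group L t))"
  using assms by (simp add: finite_PiE)

lemma order_power_group: "order (power_group L t) = order L ^ t"
  by (simp add: order_def card_PiE)

text \<open>If a prime \<open>p\<close> divides both numbers, choose \<open>h\<close> of order \<open>p\<close> in \<open>L\<close>. Then \<open>h\<^sup>t = 1\<close>, so the geometric
progression \<open>z = (h\<^bsup>t-1\<^esup>, \<dots>, h, 1)\<close> closes up cyclically: shifting it multiplies every entry by \<open>h\<close>,
and the constant tuple of \<open>h\<close> lies in the stabilizer.\<close>

lemma coprime_if_fixed_point_free_power_quandle:
  assumes L: "group L" "finite (carrier L)" and t: "t \<ge> 1"
    and fpf: "fixed_point_free (power_quandle L t (\<lambda>x\<in>carrier L. x))"
  shows "coprime (order L) t"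
proof (rule ccontr)
  assume "\<not> coprime (order L) t"
  then have "gcd (order L) t \<noteq> 1" by (simp add: coprime_iff_gcd_eq_1)
  then obtain p where p: "Factorial_Ring.prime p" "p dvd gcd (order L) t"
    using prime_factor_nat by blast
  let ?s = "shift_aut L t (\<lambda>x\<in>carrier L. x)" and ?D = "diag_fix L t (\<lambda>x\<in>carrier L. x)"
  interpret L: group L by (fact L(1))
  interpret P: periodic_coset_quandle "power_group L t" ?s ?D t
    by (rule periodic_coset_quandle_power[OF L(1) t])
  obtain h where h: "h \<in> carrier L" "h \<noteq> \<one>\<^bsub>L\<^esub>" "h [^]\<^bsub>L\<^esub> p = \<one>\<^bsub>L\<^esub>"
    using L.ex_element_of_prime_order[OF L(2) p(1)] p(2) by auto
  obtain m where "t = p * m" using p(2) by (auto elim: dvdE)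
  then have ht: "h [^]\<^bsub>L\<^esub> t = \<one>\<^bsub>L\<^esub>"
    using h by (simp flip: L.nat_pow_pow)
  define z where "z = (\<lambda>i\<in>{1..t}. h [^]\<^bsub>L\<^esub> (t - i))"
  define c where "c = (\<lambda>i\<in>{1..t}. h)"
  have z: "z \<in> carrier (power_group L t)" using h(1) by (simp add: z_def)
  have c: "c \<in> ?D" using h(1) unfolding diag_fix_def c_def by auto
  have cc: "c \<in> carrier (power_group L t)" using c by (rule P.H.mem_carrier)
  have "?s z = z \<otimes>\<^bsub>power_group L t\<^esub> c"
  proof (rule PiE_ext[where k = "{1..t}" and s = "\<lambda>_. carrier L"])
    show "?s z \<in> {1..t} \<rightarrow>\<^sub>E carrier L" using P.theta.hom_closed[OF z] by simp
    show "z \<otimes>\<^bsub>power_group L t\<^esub> c \<in> {1..t} \<rightarrow>\<^sub>E carrier L" using P.m_closed[OF z cc] by simp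
    fix i assume i: "i \<in> {1..t}"
    have "z i \<otimes>\<^bsub>L\<^esub> h = h [^]\<^bsub>L\<^esub> Suc (t - i)" using i by (simp add: z_def)
    moreover have "?s z i = h [^]\<^bsub>L\<^esub> Suc (t - i)"
    proof (cases "i = 1")
      case True
      then show ?thesis using shift_aut_id_apply[OF z i] t ht by (simp add: z_def flip: L.nat_pow_Suc)
    next
      case False
      then have "i - 1 \<in> {1..t}" "t - (i - 1) = Suc (t - i)" using i by auto
      then show ?thesis using False shift_aut_id_apply[OF z i] by (simp add: z_def del: L.nat_pow_Suc)
    qed
    ultimately show "?s z i = (z \<otimes>\<^bsub>power_group L t\<^esub> c) i" using i by (simp add: c_def)
  qed
  then have "c = \<one>\<^bsub>power_group L t\<^esub>"
    using P.defect_trivial_if_fixed_point_free[OF _ z c] fpf by (simp add: power_quandle_def)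
  then have "c 1 = \<one>\<^bsub>L\<^esub>" using t by simp
  then show False using h(2) t by (simp add: c_def)
qed

theorem corollary4p5:
  fixes L :: "('a, 'b) monoid_scheme" and t :: nat
    and Q :: "(nat \<Rightarrow> 'a) set lq_struct"
  assumes "simple_group L" and "finite (carrier L)" and "t \<ge> 1"
    and "Q = power_quandle L t (\<lambda>x\<in>carrier L. x)"
  shows "(superfaithful Q \<longleftrightarrow> superconnected Q) \<and> (superconnected Q \<longleftrightarrow> coprime (order L) t)"
proof -
  have L: "group L" using assms(1) by (rule simple_group.axioms(1))
  interpret Q: quandle Q
    unfolding assms(4) by (rule quandle_power_quandle[OF L group.id_in_auto[OF L] assms(3)])
  interpret P: periodic_coset_quandle "power_group L t" "shift_aut L t (\<lambda>x\<in>carrier L. x)"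
    "diag_fix L t (\<lambda>x\<in>carrier L. x)" t
    by (rule periodic_coset_quandle_power[OF L assms(3)])
  have "coprime (order L) t" if "superfaithful Q"
    using coprime_if_fixed_point_free_power_quandle[OF L assms(2,3)] that assms(4)
      Q.superfaithful_iff_fixed_point_free by metis
  moreover have "superconnected Q" if "coprime (order L) t"
  proof -
    have "coprime (order (power_group L t)) t"
      using that unfolding order_power_group by simp
    then show ?thesis
      using P.superconnected_if_coprime_order[OF finite_power_group[OF assms(2)]]
      by (simp add: assms(4) power_quandle_def)
  qed
  moreover have "superfaithful Q" if "superconnected Q"
    using Q.superconnected_imp_fixed_point_free[OF that] Q.superfaithful_iff_fixed_point_free by blast
  ultimately show ?thesis by blast
qed

end
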